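(* Every finite subdirectly irreducible member of $\mathbf{SUB}(\mathcal{LO})$ is projective in $\mathbf{SUB}(\mathcal{LO})$.
   Context: For a poset $P$, $\mathbf{Co}(P)$ is the lattice of all order-convex subsets of $P$, ordered by inclusion ($X\subseteq P$ is order-convex if $x\leq z\leq y$ and $x,y\in X$ imply $z\in X$). $\mathbf{SUB}(\mathcal{LO})$ is the class of all lattices that can be embedded into a lattice of the form $\prod_{i\in I}\mathbf{Co}(T_i)$ for some family $\langle T_i\mid i\in I\rangle$ of chains (totally ordered sets); it is a variety of lattices. A member $S$ of a variety $\mathbf{V}$ is projective in $\mathbf{V}$ if for all $K,M\in\mathbf{V}$, every surjective homomorphism $f\colon K\to M$ and every homomorphism $g\colon S\to M$, there is a homomorphism $h\colon S\to K$ with $f\circ h=g$; equivalently, for every $K\in\mathbf{V}$ and every surjective homomorphism $\pi\colon K\to S$ there is a homomorphism $\varphi\colon S\to K$ with $\pi\circ\varphi=\mathrm{id}_S$. *)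

theory Defs
  imports "HOL-Algebra.Lattice"
begin

text \<open>Lattices and posets are the carrier-based structures of HOL-Algebra. As HOL-Algebra.Lattice
  is imported, \<open>lattice\<close> below is its locale predicate, not the type class of the same name.\<close>

definition Co :: "'t gorder \<Rightarrow> 't set gorder" where
  "Co P = \<lparr>carrier = {X. X \<subseteq> carrier P \<and>
              (\<forall>x\<in>X. \<forall>y\<in>X. \<forall>z\<in>carrier P. x \<sqsubseteq>\<^bsub>P\<^esub> z \<and> z \<sqsubseteq>\<^bsub>P\<^esub> y \<longrightarrow> z \<in> X)},
            eq = (=), le = (\<subseteq>)\<rparr>"

definition lattice_prod :: "'i set \<Rightarrow> ('i \<Rightarrow> 'a gorder) \<Rightarrow> ('i \<Rightarrow> 'a) gorder" where
  "lattice_prod I L = \<lparr>carrier = (\<Pi>\<^sub>E i\<in>I. carrier (L i)),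
                       eq = (=), le = (\<lambda>f g. \<forall>i\<in>I. f i \<sqsubseteq>\<^bsub>L i\<^esub> g i)\<rparr>"

text \<open>The predicates \<^const>\<open>join_pres\<close> and \<^const>\<open>meet_pres\<close> also state that source and target are
  lattices. For the products of lattices \<open>Co P\<close> used below this always holds; see
  \<open>lattice_Co\<close> and \<open>lattice_lattice_prod\<close>.\<close>

definition lattice_hom :: "'a gorder \<Rightarrow> 'b gorder \<Rightarrow> ('a \<Rightarrow> 'b) set" where
  "lattice_hom K L = {f \<in> carrier K \<rightarrow> carrier L. join_pres K L f \<and> meet_pres K L f}"

definition lattice_congruence :: "'a gorder \<Rightarrow> ('a \<times> 'a) set \<Rightarrow> bool" where
  "lattice_congruence L \<theta> \<longleftrightarrow> equiv (carrier L) \<theta> \<and>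
     (\<forall>a b c d. (a, b) \<in> \<theta> \<and> (c, d) \<in> \<theta> \<longrightarrow>
        (a \<squnion>\<^bsub>L\<^esub> c, b \<squnion>\<^bsub>L\<^esub> d) \<in> \<theta> \<and> (a \<sqinter>\<^bsub>L\<^esub> c, b \<sqinter>\<^bsub>L\<^esub> d) \<in> \<theta>)"

text \<open>There is a least congruence distinct from equality (the monolith); in particular,
  subdirectly irreducible lattices have at least two elements.\<close>

definition subdirectly_irreducible :: "'a gorder \<Rightarrow> bool" where
  "subdirectly_irreducible L \<longleftrightarrow> lattice L \<and>
     (\<exists>\<mu>. lattice_congruence L \<mu> \<and> \<mu> \<noteq> Id_on (carrier L) \<and>
          (\<forall>\<theta>. lattice_congruence L \<theta> \<and> \<theta> \<noteq> Id_on (carrier L) \<longrightarrow> \<mu> \<subseteq> \<theta>))"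

text \<open>HOL cannot quantify existentially over types, so the types \<open>'i\<close> of the indices and \<open>'t\<close> of
  the points of the chains are parameters. In a statement where membership in the class occurs
  only as a hypothesis and these types are free type variables, a family of chains over
  arbitrary types is allowed.\<close>

definition SUB_LO :: "'i itself \<Rightarrow> 't itself \<Rightarrow> 'a gorder set" where
  "SUB_LO _ _ = {L. lattice L \<and>
     (\<exists>(I :: 'i set) (T :: 'i \<Rightarrow> 't gorder) e.
        (\<forall>i\<in>I. total_order (T i)) \<and>
        e \<in> lattice_hom L (lattice_prod I (\<lambda>i. Co (T i))) \<and> inj_on e (carrier L))}"

text \<open>\<open>V\<close> and \<open>W\<close> stand for the same class of lattices, at the type of the elements of \<open>K\<close> and at
  that of the elements of \<open>M\<close>; the membership of \<open>S\<close> in the class is to be stated separately.\<close>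

definition projective_in :: "'k gorder set \<Rightarrow> 'm gorder set \<Rightarrow> 's gorder \<Rightarrow> bool" where
  "projective_in V W S \<longleftrightarrow>
     (\<forall>K\<in>V. \<forall>M\<in>W. \<forall>f\<in>lattice_hom K M. \<forall>g\<in>lattice_hom S M.
        f ` carrier K = carrier M \<longrightarrow>
        (\<exists>h\<in>lattice_hom S K. \<forall>x\<in>carrier S. f (h x) = g x))"

lemma lattice_Co: "lattice (Co P)"
proof -
  have le: "le (Co P) = (\<subseteq>)" and eq: "eq (Co P) = (=)"
    by (simp_all add: Co_def)
  have po: "partial_order (Co P)"
    by (unfold_locales, unfold le eq) blast+
  have sup: "\<exists>s. least (Co P) s (Upper (Co P) {X, Y})"
    if "X \<in> carrier (Co P)" "Y \<in> carrier (Co P)" for X Y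
  proof -
    define C where "C = carrier (Co P)"
    define F where "F = {Z \<in> C. X \<union> Y \<subseteq> Z}"
    have "carrier P \<in> F"
      using that unfolding F_def C_def Co_def by simp
    moreover from this have "\<Inter>F \<in> C"
      unfolding F_def C_def Co_def by (simp, blast)
    moreover have "X \<union> Y \<subseteq> \<Inter>F"
      unfolding F_def by blast
    ultimately have "least (Co P) (\<Inter>F) (Upper (Co P) {X, Y})"
      using that unfolding least_def Upper_def le C_def[symmetric] F_def by auto
    then show ?thesis by blast
  qed
  have inf: "\<exists>s. greatest (Co P) s (Lower (Co P) {X, Y})"
    if "X \<in> carrier (Co P)" "Y \<in> carrier (Co P)" for X Y
  proof -
    have XY: "X \<inter> Y \<in> carrier (Co P)"
      using that unfolding Co_def by (simp, blast)
    have "greatest (Co P) (X \<inter> Y) (Lower (Co P) {X, Y})"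
      using that XY unfolding greatest_def Lower_def le by auto
    then show ?thesis by blast
  qed
  show ?thesis
    by (intro lattice.intro upper_semilattice.intro lower_semilattice.intro
        upper_semilattice_axioms.intro lower_semilattice_axioms.intro po sup inf)
qed

lemma lattice_lattice_prod:
  assumes L: "\<And>i. i \<in> I \<Longrightarrow> lattice (L i)"
  shows "lattice (lattice_prod I L)"
proof -
  let ?P = "lattice_prod I L"
  have car: "x \<in> carrier ?P \<longleftrightarrow> x \<in> extensional I \<and> (\<forall>i\<in>I. x i \<in> carrier (L i))" for x
    by (auto simp: lattice_prod_def PiE_iff)
  have le: "x \<sqsubseteq>\<^bsub>?P\<^esub> y \<longleftrightarrow> (\<forall>i\<in>I. x i \<sqsubseteq>\<^bsub>L i\<^esub> y i)" for x y
    by (simp add: lattice_prod_def)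
  have eq: "eq ?P = (=)"
    by (simp add: lattice_prod_def)
  have U: "upper_semilattice (L i)" and W: "lower_semilattice (L i)" if "i \<in> I" for i
    using L[OF that] by (rule lattice.axioms)+
  have A: "partial_order (L i)" if "i \<in> I" for i
    using U[OF that] by (rule upper_semilattice.axioms)
  have B: "weak_partial_order (L i)" if "i \<in> I" for i
    using A[OF that] by (rule partial_order.axioms)
  have po: "partial_order ?P"
  proof (unfold_locales, unfold eq le)
    fix x assume "x \<in> carrier ?P"
    then show "\<forall>i\<in>I. x i \<sqsubseteq>\<^bsub>L i\<^esub> x i"
      using weak_partial_order.le_refl[OF B] by (simp add: car)
  next
    fix x y
    assume "\<forall>i\<in>I. x i \<sqsubseteq>\<^bsub>L i\<^esub> y i" "\<forall>i\<in>I. y i \<sqsubseteq>\<^bsub>L i\<^esub> x i"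
      and xy: "x \<in> carrier ?P" "y \<in> carrier ?P"
    then have "x i = y i" if "i \<in> I" for i
      using that partial_order.le_antisym[OF A[OF that]] by (simp add: car)
    then show "x = y"
      using xy by (meson car extensionalityI)
  next
    fix x y z
    assume "\<forall>i\<in>I. x i \<sqsubseteq>\<^bsub>L i\<^esub> y i" "\<forall>i\<in>I. y i \<sqsubseteq>\<^bsub>L i\<^esub> z i"
      and xyz: "x \<in> carrier ?P" "y \<in> carrier ?P" "z \<in> carrier ?P"
    then show "\<forall>i\<in>I. x i \<sqsubseteq>\<^bsub>L i\<^esub> z i"
      by (meson B car weak_partial_order.le_trans)
  qed simp_all
  have sup: "\<exists>s. least ?P s (Upper ?P {x, y})"
    if xy: "x \<in> carrier ?P" "y \<in> carrier ?P" for x y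
  proof -
    have "\<forall>i\<in>I. \<exists>s. least (L i) s (Upper (L i) {x i, y i})"
      using that by (simp add: car U upper_semilattice.sup_of_two_exists)
    then obtain s where s: "\<forall>i\<in>I. least (L i) (s i) (Upper (L i) {x i, y i})" by metis
    have "s i \<in> carrier (L i) \<and> x i \<sqsubseteq>\<^bsub>L i\<^esub> s i \<and> y i \<sqsubseteq>\<^bsub>L i\<^esub> s i \<and>
        (\<forall>w\<in>carrier (L i). x i \<sqsubseteq>\<^bsub>L i\<^esub> w \<and> y i \<sqsubseteq>\<^bsub>L i\<^esub> w \<longrightarrow> s i \<sqsubseteq>\<^bsub>L i\<^esub> w)" if i: "i \<in> I" for i
    proof -
      have "x i \<in> carrier (L i)" "y i \<in> carrier (L i)"
        using that xy by (simp_all add: car)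
      then show ?thesis
        using bspec[OF s i] unfolding least_def Upper_def by blast
    qed
    then have "least ?P (restrict s I) (Upper ?P {x, y})"
      using xy by (simp add: least_def Upper_def car le subset_iff)
    then show ?thesis by blast
  qed
  have inf: "\<exists>s. greatest ?P s (Lower ?P {x, y})"
    if xy: "x \<in> carrier ?P" "y \<in> carrier ?P" for x y
  proof -
    have "\<forall>i\<in>I. \<exists>s. greatest (L i) s (Lower (L i) {x i, y i})"
      using that by (simp add: car W lower_semilattice.inf_of_two_exists)
    then obtain s where s: "\<forall>i\<in>I. greatest (L i) (s i) (Lower (L i) {x i, y i})" by metis
    have "s i \<in> carrier (L i) \<and> s i \<sqsubseteq>\<^bsub>L i\<^esub> x i \<and> s i \<sqsubseteq>\<^bsub>L i\<^esub> y i \<and>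
        (\<forall>w\<in>carrier (L i). w \<sqsubseteq>\<^bsub>L i\<^esub> x i \<and> w \<sqsubseteq>\<^bsub>L i\<^esub> y i \<longrightarrow> w \<sqsubseteq>\<^bsub>L i\<^esub> s i)" if i: "i \<in> I" for i
    proof -
      have "x i \<in> carrier (L i)" "y i \<in> carrier (L i)"
        using that xy by (simp_all add: car)
      then show ?thesis
        using bspec[OF s i] unfolding greatest_def Lower_def by blast
    qed
    then have "greatest ?P (restrict s I) (Lower ?P {x, y})"
      using xy by (simp add: greatest_def Lower_def car le subset_iff)
    then show ?thesis by blast
  qed
  show ?thesis
    by (intro lattice.intro upper_semilattice.intro lower_semilattice.intro
        upper_semilattice_axioms.intro lower_semilattice_axioms.intro po sup inf)
qed

end

theory Submission
  imports Defs
begin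

text \<open>
  The coordinate embeddings of a subdirectly irreducible lattice \<open>S\<close> into lattices \<open>Co T\<close> separate
  its monolith pair, so one of them is injective. If \<open>S\<close> is finite, comparing traces on one point of
  each atom and one further point \<open>u\<close> is already a congruence, hence these finitely many points
  determine the elements of \<open>S\<close>. This leaves the two-element lattice, \<open>Co\<close> of a finite chain, and
  \<open>Co\<close> of a finite chain with one inner singleton \<open>{u}\<close> replaced by a two-element interval.

  In each case there are lattice terms, one for every element \<open>s\<close> of \<open>S\<close>, which return \<open>s\<close> when
  evaluated at the join-irreducible elements, and which form a homomorphic image of \<open>S\<close> when
  evaluated at arbitrary convex subsets of an arbitrary chain: if the given sets are not disjoint and
  monotonically ordered, then the terms collapse all the inner atoms to the bottom. Evaluated at
  preimages in \<open>K\<close> of the generators, these terms lift the homomorphism to \<open>K\<close>.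
\<close>

section \<open>Convex subsets of a linear order\<close>

text \<open>One family of terms has to serve every coordinate of \<open>K\<close>. Preimages of the
  generators need satisfy none of the relations between the generators, and their arrangement may
  change from coordinate to coordinate, so the lift cannot depend on a case distinction: the terms
  must react to the arrangement by themselves. Reversing a chain does not change its convex subsets,
  so atoms that appear in the opposite order do no harm. Where the arrangement is bad, the terms
  keep of an element only whether it lies above the atom at either end. This is compatible with
  joins, because a hull never gains an end of the chain. For disjoint atoms it is achieved by two
  passes, one from the last atom downwards and one upwards, which cut each atom down to the part
  between one end and the neighbour treated before; an empty intersection thereby spreads to all
  inner atoms. Overlapping atoms need another device. Terms have no constant for the bottom, so the
  bottom is built from meets, and these are chosen such that a single common point makes them absorb
  the inner atoms.\<close>

definition chull :: "('a \<Rightarrow> 'a \<Rightarrow> bool) \<Rightarrow> 'a set \<Rightarrow> 'a set" where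
  "chull r A = {z. \<exists>x\<in>A. \<exists>y\<in>A. r x z \<and> r z y}"

lemma chull_mono: "A \<subseteq> B \<Longrightarrow> chull r A \<subseteq> chull r B"
  by (auto simp: chull_def)

lemma chull_empty [simp]: "chull r {} = {}"
  by (simp add: chull_def)

lemma chull_dual: "chull (\<lambda>x y. r y x) = chull r"
  by (auto simp: chull_def fun_eq_iff)

definition order_convex :: "('a \<Rightarrow> 'a \<Rightarrow> bool) \<Rightarrow> 'a set \<Rightarrow> bool" where
  "order_convex r A \<longleftrightarrow> chull r A = A"

lemma order_convex_dual: "order_convex (\<lambda>x y. r y x) = order_convex r"
  by (simp add: order_convex_def fun_eq_iff chull_dual[of r])

context linorder
begin

lemma chull_subset: "A \<subseteq> chull (\<le>) A"
  by (auto simp: chull_def)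

lemma order_convex_iff:
  "order_convex (\<le>) A \<longleftrightarrow> (\<forall>x\<in>A. \<forall>y\<in>A. \<forall>z. x \<le> z \<and> z \<le> y \<longrightarrow> z \<in> A)"
  unfolding order_convex_def chull_def set_eq_iff mem_Collect_eq using local.order_refl by blast

lemma order_convexD: "order_convex (\<le>) A \<Longrightarrow> x \<in> A \<Longrightarrow> y \<in> A \<Longrightarrow> x \<le> z \<Longrightarrow> z \<le> y \<Longrightarrow> z \<in> A"
  unfolding order_convex_iff by blast

lemma order_convex_chull [simp]: "order_convex (\<le>) (chull (\<le>) A)"
  unfolding order_convex_iff chull_def
  by (clarify, metis local.order_trans)

lemma order_convex_Int: "order_convex (\<le>) A \<Longrightarrow> order_convex (\<le>) B \<Longrightarrow> order_convex (\<le>) (A \<inter> B)"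
  unfolding order_convex_iff by blast

lemma chull_least: "A \<subseteq> B \<Longrightarrow> order_convex (\<le>) B \<Longrightarrow> chull (\<le>) A \<subseteq> B"
  unfolding order_convex_def using chull_mono by metis

lemma chull_Un_chull: "chull (\<le>) (A \<union> chull (\<le>) B) = chull (\<le>) (A \<union> B)"
proof (rule antisym)
  show "chull (\<le>) (A \<union> chull (\<le>) B) \<subseteq> chull (\<le>) (A \<union> B)"
    using chull_subset[of "A \<union> B"] chull_mono[of B "A \<union> B" "(\<le>)"] by (intro chull_least) auto
  show "chull (\<le>) (A \<union> B) \<subseteq> chull (\<le>) (A \<union> chull (\<le>) B)"
    using chull_subset[of B] by (intro chull_mono) auto
qed

text \<open>A common point \<open>w\<close> splits each segment with ends in the union: a point of
  the segment lies between \<open>w\<close> and one of the ends, and these two belong to a common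
  convex set.\<close>

lemma order_convex_Un:
  assumes "order_convex (\<le>) A" "order_convex (\<le>) B" "A \<inter> B \<noteq> {}"
  shows "order_convex (\<le>) (A \<union> B)"
  unfolding order_convex_iff
proof (intro ballI allI impI)
  fix x y z assume *: "x \<in> A \<union> B" "y \<in> A \<union> B" "x \<le> z \<and> z \<le> y"
  obtain w where "w \<in> A" "w \<in> B" using assms(3) by blast
  then show "z \<in> A \<union> B"
    using * order_convexD[OF assms(1), of x w z] order_convexD[OF assms(1), of w y z]
      order_convexD[OF assms(2), of x w z] order_convexD[OF assms(2), of w y z]
      order_convexD[OF assms(1), of x y z] order_convexD[OF assms(2), of x y z]
      linear[of z w] by fast
qed

text \<open>Vacuous if one of the sets is empty, which is why transitivity and asymmetry below ask
  for nonempty sets.\<close>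

definition lies_below :: "'a set \<Rightarrow> 'a set \<Rightarrow> bool" where
  "lies_below A B \<longleftrightarrow> (\<forall>a\<in>A. \<forall>b\<in>B. a < b)"

text \<open>If both relations fail, there are \<open>b \<le> a\<close> and
  \<open>a' \<le> b'\<close>; however these four points are placed, one of them lies between two
  points of the other set and so belongs to both sets.\<close>

lemma lies_below_cases:
  assumes "order_convex (\<le>) A" "order_convex (\<le>) B" "A \<inter> B = {}"
  shows "lies_below A B \<or> lies_below B A"
proof (rule ccontr)
  assume "\<not> ?thesis"
  then obtain a b a' b' where *: "a \<in> A" "b \<in> B" "b \<le> a" "a' \<in> A" "b' \<in> B" "a' \<le> b'"
    unfolding lies_below_def by (auto simp: not_less)
  have n: "\<And>w. w \<in> A \<Longrightarrow> w \<in> B \<Longrightarrow> False" using assms(3) by blast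
  consider "a \<le> b'" | "b' \<le> a" "a' \<le> b" | "b \<le> a'" using linear by blast
  then show False
  proof cases
    case 1 then show ?thesis using order_convexD[OF assms(2) *(2,5) *(3)] *(1) n by blast
  next
    case 2 then show ?thesis using order_convexD[OF assms(1) *(4,1) _ *(3)] *(2) n by blast
  next
    case 3 then show ?thesis using order_convexD[OF assms(2) *(2,5) _ *(6)] *(4) n by blast
  qed
qed

lemma lies_below_asym: "lies_below A B \<Longrightarrow> A \<noteq> {} \<Longrightarrow> B \<noteq> {} \<Longrightarrow> \<not> lies_below B A"
  unfolding lies_below_def using less_asym by blast

lemma lies_below_trans: "lies_below A B \<Longrightarrow> lies_below B C \<Longrightarrow> B \<noteq> {} \<Longrightarrow> lies_below A C"
  unfolding lies_below_def by (blast intro: less_trans)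

end

section \<open>The two shapes of families of convex sets that carry a homomorphic image of the
  lattice\<close>

definition collapsed :: "nat \<Rightarrow> nat \<Rightarrow> 'a set \<Rightarrow> (nat \<Rightarrow> 'a set) \<Rightarrow> 'a set \<Rightarrow> bool" where
  "collapsed n c b Y YP \<longleftrightarrow> b \<subseteq> Y 0 \<and> b \<subseteq> Y n \<and> Y 0 \<inter> Y n = b \<and> (\<forall>j. 0 < j \<and> j < n \<longrightarrow> Y j = b)
     \<and> YP \<subseteq> Y (Suc c)"

text \<open>\<open>E\<close> is the set of atoms below an element and \<open>P\<close> tells whether the element lies above \<open>p\<close>, the
  join-irreducible element other than the atoms, which sits between the atoms \<open>c\<close> and \<open>Suc c\<close> and
  covers the latter.\<close>

definition trace :: "nat \<Rightarrow> nat \<Rightarrow> nat set \<Rightarrow> bool \<Rightarrow> bool" where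
  "trace n c E P \<longleftrightarrow> E \<subseteq> {..n} \<and> order_convex (\<le>) E \<and> (P \<longrightarrow> Suc c \<in> E) \<and> (c \<in> E \<and> Suc c \<in> E \<longrightarrow> P)"

context linorder
begin

lemma mem_chull_Un_cases:
  assumes "z \<in> chull (\<le>) (A \<union> B)" "order_convex (\<le>) A" "order_convex (\<le>) B"
  obtains "z \<in> A" | "z \<in> B" | a b where "a \<in> A" "b \<in> B" "a \<le> z" "z \<le> b"
    | a b where "a \<in> A" "b \<in> B" "b \<le> z" "z \<le> a"
  using assms unfolding order_convex_iff chull_def by blast

lemma subset_chull_Un: "A \<subseteq> chull (\<le>) (A \<union> B)" "B \<subseteq> chull (\<le>) (A \<union> B)"
  using chull_subset[of "A \<union> B"] by simp_all

text \<open>The intended arrangement: \<open>b\<close> stands for the bottom, the sets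
  \<open>Y j\<close> for the atoms in increasing order, and \<open>YP\<close> for the element
  \<open>p\<close> between the atoms \<open>c\<close> and \<open>Suc c\<close>.\<close>

definition separated :: "nat \<Rightarrow> nat \<Rightarrow> 'a set \<Rightarrow> (nat \<Rightarrow> 'a set) \<Rightarrow> 'a set \<Rightarrow> bool" where
  "separated n c b Y YP \<longleftrightarrow> b = {} \<and> (\<forall>j\<le>n. Y j \<noteq> {}) \<and> (\<forall>j<n. lies_below (Y j) (Y (Suc j)))
     \<and> Y (Suc c) \<subseteq> YP \<and> YP \<subseteq> chull (\<le>) (Y c \<union> Y (Suc c)) \<and> YP \<inter> Y c = {}"

text \<open>The join of the generators below the element with trace \<open>E\<close>,
  \<open>P\<close>. Adding \<open>b\<close> provides a value for the empty trace.\<close>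

definition realized :: "'a set \<Rightarrow> (nat \<Rightarrow> 'a set) \<Rightarrow> 'a set \<Rightarrow> nat set \<Rightarrow> bool \<Rightarrow> 'a set" where
  "realized b Y YP E P = chull (\<le>) (b \<union> (\<Union>j\<in>E. Y j) \<union> (if P then YP else {}))"

text \<open>Inner sets \<open>Y j\<close> equal \<open>b\<close> and contribute nothing, while
  \<open>YP\<close> is swallowed by \<open>Y (Suc c)\<close>, whose index belongs to
  \<open>E\<close> whenever \<open>P\<close> holds. Of the trace only the membership of
  \<open>0\<close> and \<open>n\<close> remains.\<close>

lemma collapsed_realized:
  assumes col: "collapsed n c b Y YP" and c: "c < n" and E: "E \<subseteq> {..n}" "P \<longrightarrow> Suc c \<in> E"
  shows "realized b Y YP E P =
    chull (\<le>) (b \<union> (if 0 \<in> E then Y 0 else {}) \<union> (if n \<in> E then Y n else {}))"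
proof -
  have "b \<union> (\<Union>j\<in>E. Y j) \<union> (if P then YP else {}) =
     b \<union> (if 0 \<in> E then Y 0 else {}) \<union> (if n \<in> E then Y n else {})" (is "?l = ?r")
  proof
    show "?r \<subseteq> ?l" by auto
    have "Y j \<subseteq> ?r" if "j \<in> E" for j
    proof (cases "j = 0 \<or> j = n")
      case False
      then have "0 < j" "j < n" using that E by auto
      then show ?thesis using col unfolding collapsed_def by blast
    qed (use that in auto)
    then have "(\<Union>j\<in>E. Y j) \<subseteq> ?r" by blast
    moreover have "(if P then YP else {}) \<subseteq> ?r"
    proof (cases P)
      case True
      then have "YP \<subseteq> Y (Suc c)" "Suc c \<in> E" using E col by (simp_all add: collapsed_def)
      then show ?thesis using calculation True by (simp only: if_True) blast
    qed simp
    moreover have "b \<subseteq> ?r" by blast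
    ultimately show "?l \<subseteq> ?r" by - (intro Un_least, assumption+)
  qed
  then show ?thesis by (simp add: realized_def)
qed

text \<open>The only values are \<open>b\<close>, \<open>Y 0\<close>, \<open>Y n\<close> and the
  hull \<open>T\<close> of the two ends. They form a square with
  \<open>Y 0 \<inter> Y n = b\<close>, so the claim is a finite table indexed by the end indices of
  the two traces.\<close>

lemma collapsed_meet:
  assumes "collapsed n c b Y YP" "c < n" "trace n c E P" "trace n c E' P'"
    and cv: "order_convex (\<le>) b" "order_convex (\<le>) (Y 0)" "order_convex (\<le>) (Y n)"
  shows "realized b Y YP (E \<inter> E') (P \<and> P') = realized b Y YP E P \<inter> realized b Y YP E' P'"
proof -
  have t: "E \<subseteq> {..n}" "P \<longrightarrow> Suc c \<in> E" "E' \<subseteq> {..n}" "P' \<longrightarrow> Suc c \<in> E'" "E \<inter> E' \<subseteq> {..n}"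
    "P \<and> P' \<longrightarrow> Suc c \<in> E \<inter> E'"
    using assms(3,4) by (auto simp: trace_def)
  define T where "T = chull (\<le>) (Y 0 \<union> Y n)"
  have b: "b \<union> Y 0 = Y 0" "b \<union> Y n = Y n" "Y 0 \<inter> Y n = b" "b \<subseteq> Y 0" "b \<subseteq> Y n"
    using assms(1) by (auto simp: collapsed_def)
  have T: "Y 0 \<subseteq> T" "Y n \<subseteq> T" using subset_chull_Un by (auto simp: T_def)
  have "b \<subseteq> T" using b(4) T(1) by (rule subset_trans)
  then have i: "b \<inter> b = b" "b \<inter> Y 0 = b" "Y 0 \<inter> b = b" "b \<inter> Y n = b" "Y n \<inter> b = b" "b \<inter> T = b" "T \<inter> b = b"
    "Y 0 \<inter> Y 0 = Y 0" "Y 0 \<inter> Y n = b" "Y n \<inter> Y 0 = b" "Y 0 \<inter> T = Y 0" "T \<inter> Y 0 = Y 0"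
    "Y n \<inter> Y n = Y n" "Y n \<inter> T = Y n" "T \<inter> Y n = Y n" "T \<inter> T = T"
    using b(3-5) T by (simp_all only: Int_absorb Int_absorb1 Int_absorb2 Int_commute[of "Y n"])
  have h: "chull (\<le>) b = b" "chull (\<le>) (Y 0) = Y 0" "chull (\<le>) (Y n) = Y n"
    using cv by (simp_all add: order_convex_def)
  have G: "chull (\<le>) (b \<union> (if k then Y 0 else {}) \<union> (if l then Y n else {})) =
      (if k then if l then T else Y 0 else if l then Y n else b)" for k l
    by (simp add: b h T_def)
  show ?thesis
    unfolding collapsed_realized[OF assms(1,2) t(1,2)] collapsed_realized[OF assms(1,2) t(3,4)]
      collapsed_realized[OF assms(1,2) t(5,6)] G Int_iff
    by (cases "0 \<in> E"; cases "0 \<in> E'"; cases "n \<in> E"; cases "n \<in> E'";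
        simp only: i if_True if_False simp_thms)
qed

lemma chull_nat_iff: "k \<in> chull (\<le>) (E \<union> E') \<longleftrightarrow> (\<exists>i\<in>E \<union> E'. \<exists>j\<in>E \<union> E'. i \<le> k \<and> k \<le> j)" for k :: nat
  by (auto simp: chull_def)

text \<open>As \<open>0\<close> and \<open>n\<close> are the extreme indices, the hull of
  \<open>E \<union> E'\<close> contains one of them only if \<open>E\<close> or \<open>E'\<close>
  does. Hence restricting traces to the end indices turns hulls into unions.\<close>

lemma collapsed_join:
  assumes "collapsed n c b Y YP" "c < n" "trace n c E P" "trace n c E' P'"
    and F: "F = chull (\<le>) (E \<union> E')" and Q: "Q \<longleftrightarrow> P \<or> P' \<or> (c \<in> F \<and> Suc c \<in> F)"
  shows "realized b Y YP F Q = chull (\<le>) (realized b Y YP E P \<union> realized b Y YP E' P')"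
proof -
  have t: "E \<subseteq> {..n}" "P \<longrightarrow> Suc c \<in> E" "E' \<subseteq> {..n}" "P' \<longrightarrow> Suc c \<in> E'"
    using assms(3,4) by (auto simp: trace_def)
  have t': "F \<subseteq> {..n}" "Q \<longrightarrow> Suc c \<in> F"
    unfolding F Q using t by (fastforce simp: chull_nat_iff)+
  have 0: "0 \<in> F \<longleftrightarrow> 0 \<in> E \<or> 0 \<in> E'" by (auto simp: F chull_nat_iff)
  have n: "n \<in> F \<longleftrightarrow> n \<in> E \<or> n \<in> E'" using t by (fastforce simp: F chull_nat_iff)
  have *: "chull (\<le>) (chull (\<le>) A \<union> chull (\<le>) B) = chull (\<le>) (A \<union> B)" for A B :: "'a set"
    using chull_Un_chull[of "chull (\<le>) A" B] chull_Un_chull[of B A] by (simp add: Un_commute)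
  show ?thesis
    unfolding collapsed_realized[OF assms(1,2) t(1,2)] collapsed_realized[OF assms(1,2) t(3,4)]
      collapsed_realized[OF assms(1,2) t'] * 0 n
    by (rule arg_cong[where f = "chull (\<le>)"]) auto
qed

lemma separated_less:
  assumes "separated n c b Y YP" "i < j" "j \<le> n"
  shows "lies_below (Y i) (Y j)"
  using assms(2,3)
proof (induction j rule: less_induct)
  case (less j)
  then obtain k where k: "j = Suc k" by (cases j) auto
  have *: "lies_below (Y k) (Y (Suc k))" "Y k \<noteq> {}" using assms(1) less.prems k by (auto simp: separated_def)
  show ?case
  proof (cases "i = k")
    case False
    then show ?thesis using less.IH[of k] less.prems k * lies_below_trans by auto
  qed (use * k in simp)
qed

lemma separated_mem_order:
  assumes "separated n c b Y YP" "x \<in> Y i" "y \<in> Y j" "x \<le> y" "i \<le> n" "j \<le> n"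
  shows "i \<le> j"
  using separated_less[OF assms(1), of j i] assms by (force simp: lies_below_def not_le)

text \<open>\<open>YP\<close> avoids \<open>Y c\<close> but stays within the hull of
  \<open>Y c\<close> and \<open>Y (Suc c)\<close>, so each of its points is in
  \<open>Y (Suc c)\<close> or strictly in the gap before it. This locates the points of
  \<open>YP\<close> relative to all the sets \<open>Y j\<close>.\<close>

lemma separated_YP:
  assumes sep: "separated n c b Y YP" and c: "c < n" and x: "x \<in> YP"
    and cv: "\<And>j. order_convex (\<le>) (Y j)"
  shows "(\<forall>y\<in>Y c. y < x) \<and> (x \<in> Y (Suc c) \<or> (\<forall>y\<in>Y (Suc c). x < y))"
proof -
  have s: "lies_below (Y c) (Y (Suc c))" "x \<in> chull (\<le>) (Y c \<union> Y (Suc c))" "x \<notin> Y c"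
    using sep c x by (auto simp: separated_def)
  have *: "y < x" if "y \<in> Y c" for y
    using s(2) cv cv
  proof (cases rule: mem_chull_Un_cases)
    case (3 u v)
    then have "y \<noteq> x" "\<not> x \<le> y" using that s(3) order_convexD[OF cv, of u c y x] by blast+
    then show ?thesis by (simp add: not_le)
  next
    case (4 u v)
    then show ?thesis using s(1) by (meson lies_below_def le_less_trans less_le_not_le order_trans)
  qed (use s that in \<open>auto simp: lies_below_def\<close>)
  have "x < y" if "y \<in> Y (Suc c)" "x \<notin> Y (Suc c)" for y
    using s(2) cv cv
  proof (cases rule: mem_chull_Un_cases)
    case (3 u v)
    then have "\<not> y \<le> x" using that order_convexD[OF cv, of y "Suc c" v x] by blast
    then show ?thesis by (simp add: not_le)
  next
    case (4 u v)
    then show ?thesis using s(1) by (meson lies_below_def le_less_trans less_le_not_le order_trans)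
  qed (use s that in auto)
  with * show ?thesis by blast
qed

text \<open>A point of the hull is trapped between two generating points. The order of the sets
  \<open>Y j\<close> turns these into indices of \<open>E\<close> on both sides of \<open>j\<close>,
  and \<open>E\<close> is convex. A trapping point from \<open>YP\<close> counts with the index
  \<open>Suc c\<close>, which \<open>P\<close> puts into \<open>E\<close>.\<close>

lemma separated_realized_iff_mem:
  assumes sep: "separated n c b Y YP" and c: "c < n" and tr: "trace n c E P"
    and cv: "\<And>j. order_convex (\<le>) (Y j)" and u: "u \<in> Y j" "j \<le> n"
  shows "u \<in> realized b Y YP E P \<longleftrightarrow> j \<in> E"
proof
  assume "j \<in> E"
  then show "u \<in> realized b Y YP E P"
    using u chull_subset[of "b \<union> (\<Union>j\<in>E. Y j) \<union> (if P then YP else {})"]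
    unfolding realized_def by blast
next
  have E: "E \<subseteq> {..n}" "order_convex (\<le>) E" "P \<Longrightarrow> Suc c \<in> E" using tr by (auto simp: trace_def)
  assume "u \<in> realized b Y YP E P"
  then obtain x y where xy: "x \<le> u" "u \<le> y" "x \<in> (\<Union>j\<in>E. Y j) \<or> P \<and> x \<in> YP" "y \<in> (\<Union>j\<in>E. Y j) \<or> P \<and> y \<in> YP"
    using sep by (auto simp: realized_def chull_def separated_def split: if_splits)
  have lt: "lies_below (Y i) (Y k)" if "i < k" "k \<le> n" for i k
    using separated_less[OF sep] that .
  have "\<exists>i\<in>E. i \<le> j" using xy(3)
  proof
    assume "x \<in> (\<Union>j\<in>E. Y j)"
    then obtain i where i: "i \<in> E" "x \<in> Y i" by blast
    then have "i \<le> j" using separated_mem_order[OF sep _ u(1) xy(1)] E u(2) by auto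
    then show ?thesis using i by blast
  next
    assume *: "P \<and> x \<in> YP"
    have "\<not> j \<le> c"
    proof
      assume "j \<le> c"
      obtain v where "v \<in> Y c"
        using sep c unfolding separated_def by (meson all_not_in_conv less_imp_le_nat)
      then obtain y where y: "y \<in> Y c" "u \<le> y"
        using lt[of j c] c u \<open>j \<le> c\<close> unfolding lies_below_def
        by (cases "j = c") (auto intro: less_imp_le)
      then have "y < x" using separated_YP[OF sep c _ cv] * by blast
      then show False using y xy(1) by (meson leD order_trans)
    qed
    then show ?thesis using * E by (intro bexI[of _ "Suc c"]) auto
  qed
  moreover have "\<exists>k\<in>E. j \<le> k" using xy(4)
  proof
    assume "y \<in> (\<Union>j\<in>E. Y j)"
    then obtain i where i: "i \<in> E" "y \<in> Y i" by blast
    then have "j \<le> i" using separated_mem_order[OF sep u(1) _ xy(2)] E u(2) by auto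
    then show ?thesis using i by blast
  next
    assume *: "P \<and> y \<in> YP"
    have "\<not> Suc c < j"
    proof
      assume "Suc c < j"
      then have l: "lies_below (Y (Suc c)) (Y j)" "Y (Suc c) \<noteq> {}"
        using lt u c sep by (auto simp: separated_def)
      then obtain w where w: "w \<in> Y (Suc c)" "w < u" using u unfolding lies_below_def by blast
      then have "y \<in> Y (Suc c)"
        using separated_YP[OF sep c _ cv, of y] * xy(2) by (meson less_asym less_le_trans)
      then show False using l(1) u(1) xy(2) unfolding lies_below_def by (meson leD)
    qed
    then show ?thesis using * E by (intro bexI[of _ "Suc c"]) auto
  qed
  ultimately show "j \<in> E" using E(2) unfolding linorder_class.order_convex_iff by blast
qed

text \<open>A point outside all the \<open>Y j\<close> lies in a gap \<open>{i, Suc i}\<close>, and whether it belongs to a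
  realized set is decided by that gap alone.\<close>

lemma separated_realized_iff_gap:
  assumes sep: "separated n c b Y YP" and c: "c < n" and tr: "trace n c E P"
    and cv: "\<And>j. order_convex (\<le>) (Y j)" "order_convex (\<le>) YP"
    and i: "i < n" "\<forall>x\<in>Y i. x < u" "\<forall>x\<in>Y (Suc i). u < x"
  shows "u \<in> realized b Y YP E P \<longleftrightarrow> (if i = c \<and> u \<in> YP then P else i \<in> E \<and> Suc i \<in> E)"
proof
  have E: "E \<subseteq> {..n}" "order_convex (\<le>) E" "P \<Longrightarrow> Suc c \<in> E" "c \<in> E \<Longrightarrow> Suc c \<in> E \<Longrightarrow> P"
    using tr by (auto simp: trace_def)
  have ne: "Y k \<noteq> {}" if "k \<le> n" for k using sep that by (simp add: separated_def)
  {
    assume *: "if i = c \<and> u \<in> YP then P else i \<in> E \<and> Suc i \<in> E"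
    show "u \<in> realized b Y YP E P"
    proof (cases "i = c \<and> u \<in> YP")
      case True
      then show ?thesis
        using * chull_subset[of "b \<union> (\<Union>j\<in>E. Y j) \<union> (if P then YP else {})"]
        unfolding realized_def by auto
    next
      case False
      then have *: "i \<in> E" "Suc i \<in> E" using * by presburger+
      obtain x y where "x \<in> Y i" "y \<in> Y (Suc i)" using ne[of i] ne[of "Suc i"] i(1) by (metis Suc_leI all_not_in_conv less_imp_le_nat)
      then have "x \<in> (\<Union>j\<in>E. Y j)" "x \<le> u" "y \<in> (\<Union>j\<in>E. Y j)" "u \<le> y" using * i by (auto intro: less_imp_le)
      then show ?thesis unfolding realized_def chull_def by blast
    qed
  next
    assume "u \<in> realized b Y YP E P"
    then obtain x y where xy: "x \<le> u" "u \<le> y" "x \<in> (\<Union>j\<in>E. Y j) \<or> P \<and> x \<in> YP" "y \<in> (\<Union>j\<in>E. Y j) \<or> P \<and> y \<in> YP"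
      using sep by (auto simp: realized_def chull_def separated_def split: if_splits)
    obtain v w where vw: "v \<in> Y i" "w \<in> Y (Suc i)" "v < u" "u < w"
      using ne[of i] ne[of "Suc i"] i by (metis Suc_leI all_not_in_conv less_imp_le_nat)
    have lo: "k \<le> i" if "x \<in> Y k" "k \<in> E" for k
    proof (rule ccontr)
      assume "\<not> k \<le> i"
      then consider "k = Suc i" | "Suc i < k" by linarith
      then show False
      proof cases
        case 1 then show ?thesis using that i(3) xy(1) leD by blast
      next
        case 2
        then have "w < x" using separated_less[OF sep 2] that E vw(2) unfolding lies_below_def by blast
        then show ?thesis using vw(4) xy(1) by (meson leD less_trans)
      qed
    qed
    have hi: "Suc i \<le> k" if "y \<in> Y k" "k \<in> E" for k
    proof (rule ccontr)
      assume "\<not> Suc i \<le> k"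
      then consider "k = i" | "k < i" by linarith
      then show False
      proof cases
        case 1 then show ?thesis using that i(2) xy(2) leD by blast
      next
        case 2
        then have "y < v" using separated_less[OF sep 2] that i(1) vw(1) unfolding lies_below_def by auto
        then show ?thesis using vw(3) xy(2) by (meson leD less_trans)
      qed
    qed
    \<comment> \<open>The point \<open>x \<le> u\<close> lies below \<open>Y (Suc i)\<close>; for
      \<open>i < c\<close> it would lie below some point of \<open>Y c\<close>, whereas
      \<open>YP\<close> is entirely above \<open>Y c\<close>.\<close>
    have xP: "c \<le> i" if "x \<in> YP"
    proof (rule ccontr)
      assume "\<not> c \<le> i"
      then obtain z where "z \<in> Y c" "w \<le> z"
      proof (cases "Suc i = c")
        case False
        then have "lies_below (Y (Suc i)) (Y c)" using separated_less[OF sep] \<open>\<not> c \<le> i\<close> c by simp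
        then show ?thesis using that ne[of c] c vw(2) unfolding lies_below_def by (metis all_not_in_conv less_imp_le less_imp_le_nat)
      qed (use vw in auto)
      then show False using separated_YP[OF sep c \<open>x \<in> YP\<close> cv(1)] xy(1) vw(4)
        by (meson leD less_le_trans less_trans order_trans)
    qed
    \<comment> \<open>For \<open>i > c\<close> the point \<open>y\<close> would lie above a point of
      \<open>Y (Suc c)\<close>, hence inside that set, which is itself below \<open>u\<close>; but
      \<open>u \<le> y\<close>.\<close>
    have yP: "i \<le> c" if "y \<in> YP"
    proof (rule ccontr)
      assume "\<not> i \<le> c"
      then obtain z where z: "z \<in> Y (Suc c)" "z \<le> v"
      proof (cases "Suc c = i")
        case False
        then have "lies_below (Y (Suc c)) (Y i)" using separated_less[OF sep] \<open>\<not> i \<le> c\<close> i(1) by simp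
        then show ?thesis using that ne[of "Suc c"] c vw(1) unfolding lies_below_def by (metis Suc_leI all_not_in_conv less_imp_le)
      qed (use vw in auto)
      have "z < y" using z vw(3) xy(2) by (meson le_less_trans less_le_trans)
      then have "y \<in> Y (Suc c)" using separated_YP[OF sep c \<open>y \<in> YP\<close> cv(1)] z(1) less_asym by blast
      then have "y \<le> v \<or> Suc c = i"
        using separated_less[OF sep, of "Suc c" i] \<open>\<not> i \<le> c\<close> i(1) vw(1)
        unfolding lies_below_def by (cases "Suc c = i") (auto intro: less_imp_le)
      then show False
        using vw(3) xy(2) i(2) \<open>y \<in> Y (Suc c)\<close> by (metis leD le_less_trans order_trans)
    qed
    have gap: "i \<in> E \<and> Suc i \<in> E" if "k \<in> E" "k \<le> i" "l \<in> E" "Suc i \<le> l" for k l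
      using E(2) that linorder_class.order_convexD[OF E(2), of k l i]
        linorder_class.order_convexD[OF E(2), of k l "Suc i"] by simp
    have "P" if "i = c" "u \<in> YP"
    proof (rule ccontr)
      assume "\<not> P"
      then obtain k l where "k \<in> E" "x \<in> Y k" "l \<in> E" "y \<in> Y l" using xy by blast
      then show False using gap[of k l] lo hi E(4) that \<open>\<not> P\<close> by blast
    qed
    moreover have "i \<in> E \<and> Suc i \<in> E" if no: "\<not> (i = c \<and> u \<in> YP)"
    proof -
      \<comment> \<open>Either trapping point may come from a set \<open>Y k\<close> or from
        \<open>YP\<close>, which gives four combinations.\<close>
      consider k l where "k \<in> E" "x \<in> Y k" "l \<in> E" "y \<in> Y l" | k where "k \<in> E" "x \<in> Y k" "P" "y \<in> YP"
        | l where "P" "x \<in> YP" "l \<in> E" "y \<in> Y l" | "P" "x \<in> YP" "y \<in> YP"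
        using xy by blast
      then show ?thesis
      proof cases
        case 1 then show ?thesis using gap lo hi by blast
      next
        case 2
        then show ?thesis using gap[of k "Suc c"] lo yP E(3) by simp
      next
        case 3
        \<comment> \<open>For \<open>i = c\<close> the point \<open>w \<in> Y (Suc c)\<close> would
          also be in \<open>YP\<close>, and convexity would place \<open>u\<close> between
          \<open>x\<close> and \<open>w\<close> into \<open>YP\<close>.\<close>
        then have "i \<noteq> c"
          using no order_convexD[OF cv(2), of x w u] vw(2,4) xy(1) sep less_imp_le unfolding separated_def by blast
        then show ?thesis using 3 gap[of "Suc c" l] hi xP E(3) by simp
      next
        case 4
        then have "u \<in> YP" "i = c" using xP yP order_convexD[OF cv(2), of x y u] xy by auto
        then show ?thesis using no by simp
      qed
    qed
    ultimately show "if i = c \<and> u \<in> YP then P else i \<in> E \<and> Suc i \<in> E" by presburger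
  }
qed

lemma order_convex_realized: "order_convex (\<le>) (realized b Y YP E P)"
  by (simp add: realized_def)

text \<open>By convexity each \<open>Y j\<close> is entirely on one side of \<open>u\<close>. The
  hull forces \<open>Y 0\<close> to the left and \<open>Y n\<close> to the right, so there is an
  index at which the side changes.\<close>

lemma separated_gap_exists:
  assumes sep: "separated n c b Y YP" and cv: "\<And>j. order_convex (\<le>) (Y j)"
    and u: "u \<in> chull (\<le>) (Y 0 \<union> Y n)" "\<And>j. j \<le> n \<Longrightarrow> u \<notin> Y j"
  obtains i where "i < n" "\<forall>x\<in>Y i. x < u" "\<forall>x\<in>Y (Suc i). u < x"
proof -
  have side: "(\<forall>x\<in>Y j. x < u) \<or> (\<forall>x\<in>Y j. u < x)" if "j \<le> n" for j
    using order_convexD[OF cv[of j]] u(2)[OF that] by (metis linear not_le)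
  have 0: "\<forall>x\<in>Y 0. x < u" and n: "\<forall>x\<in>Y n. u < x"
  proof -
    obtain x y where xy: "x \<in> Y 0 \<union> Y n" "y \<in> Y 0 \<union> Y n" "x \<le> u" "u \<le> y" using u(1) by (auto simp: chull_def)
    have "n \<noteq> 0" using xy u(2)[of 0] cv[of 0] order_convexD[OF cv[of 0]] by (metis Un_absorb le0)
    then have l: "lies_below (Y 0) (Y n)" using separated_less[OF sep] by simp
    obtain v w where vw: "v \<in> Y 0" "w \<in> Y n" using sep unfolding separated_def by blast
    have "v < w" using vw l by (auto simp: lies_below_def)
    show "\<forall>x\<in>Y 0. x < u"
    proof (rule ccontr)
      assume "\<not> ?thesis"
      then have 1: "\<forall>x\<in>Y 0. u < x" using side[of 0] by auto
      then have "x \<in> Y n" using xy leD by blast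
      then have "v < x" using l vw by (auto simp: lies_below_def)
      then show False using 1 vw xy by (meson leD less_trans)
    qed
    show "\<forall>x\<in>Y n. u < x"
    proof (rule ccontr)
      assume "\<not> ?thesis"
      then have 1: "\<forall>x\<in>Y n. x < u" using side[of n] by auto
      then have "y \<in> Y 0" using xy leD by blast
      then have "y < w" using l vw by (auto simp: lies_below_def)
      then show False using 1 vw xy by (meson leD less_trans)
    qed
  qed
  have "\<exists>i<n. (\<forall>x\<in>Y i. x < u) \<and> \<not> (\<forall>x\<in>Y (Suc i). x < u)"
  proof (rule ccontr)
    assume *: "\<not> ?thesis"
    have "i \<le> n \<Longrightarrow> \<forall>x\<in>Y i. x < u" for i
    proof (induction i)
      case (Suc i)
      then show ?case using * Suc_le_lessD Suc_leD by blast
    qed (use 0 in simp)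
    moreover obtain w where "w \<in> Y n" using sep unfolding separated_def by blast
    ultimately show False using n less_asym by blast
  qed
  then show ?thesis using that side Suc_leI by metis
qed

lemma realized_subset_all:
  assumes sep: "separated n c b Y YP" and c: "c < n" and tr: "trace n c E P"
  shows "realized b Y YP E P \<subseteq> chull (\<le>) (Y 0 \<union> Y n)"
  unfolding realized_def
proof (rule chull_least)
  have *: "Y j \<subseteq> chull (\<le>) (Y 0 \<union> Y n)" if "j \<le> n" for j
  proof (cases "j = 0 \<or> j = n")
    case True then show ?thesis using subset_chull_Un by blast
  next
    case False
    then have l: "lies_below (Y 0) (Y j)" "lies_below (Y j) (Y n)" using separated_less[OF sep] that by auto
    obtain v w where "v \<in> Y 0" "w \<in> Y n" using sep unfolding separated_def by blast
    then show ?thesis using l unfolding lies_below_def chull_def by (blast intro: less_imp_le)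
  qed
  have "YP \<subseteq> chull (\<le>) (Y c \<union> Y (Suc c))" using sep by (simp add: separated_def)
  also have "\<dots> \<subseteq> chull (\<le>) (Y 0 \<union> Y n)" using * c by (intro chull_least) auto
  finally show "b \<union> (\<Union>j\<in>E. Y j) \<union> (if P then YP else {}) \<subseteq> chull (\<le>) (Y 0 \<union> Y n)"
    using * tr sep by (auto simp: trace_def separated_def)
qed simp

lemma trace_Int: "trace n c E P \<Longrightarrow> trace n c E' P' \<Longrightarrow> trace n c (E \<inter> E') (P \<and> P')"
  unfolding trace_def using linorder_class.order_convex_Int by blast

text \<open>For a fixed point of the chain, membership in a realized set is one fixed test on the
  trace: \<open>j \<in> E\<close>, or \<open>P\<close>, or
  \<open>i \<in> E \<and> Suc i \<in> E\<close>. Each such test commutes with the intersection of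
  traces.\<close>

lemma separated_meet:
  assumes sep: "separated n c b Y YP" and c: "c < n" and tr: "trace n c E P" "trace n c E' P'"
    and cv: "\<And>j. order_convex (\<le>) (Y j)" "order_convex (\<le>) YP"
  shows "realized b Y YP (E \<inter> E') (P \<and> P') = realized b Y YP E P \<inter> realized b Y YP E' P'"
proof -
  note tr' = trace_Int[OF tr]
  have "u \<in> realized b Y YP (E \<inter> E') (P \<and> P') \<longleftrightarrow> u \<in> realized b Y YP E P \<and> u \<in> realized b Y YP E' P'" for u
  proof (cases "u \<in> chull (\<le>) (Y 0 \<union> Y n)")
    case u: True
    show ?thesis
    proof (cases "\<exists>j\<le>n. u \<in> Y j")
      case True
      then obtain j where j: "u \<in> Y j" "j \<le> n" by blast
      show ?thesis
        by (simp add: separated_realized_iff_mem[OF sep c tr(1) cv(1) j] separated_realized_iff_mem[OF sep c tr(2) cv(1) j]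
            separated_realized_iff_mem[OF sep c tr' cv(1) j])
    next
      case False
      then obtain i where i: "i < n" "\<forall>x\<in>Y i. x < u" "\<forall>x\<in>Y (Suc i). u < x"
        using separated_gap_exists[OF sep cv(1) u] by blast
      show ?thesis
        unfolding separated_realized_iff_gap[OF sep c tr(1) cv i] separated_realized_iff_gap[OF sep c tr(2) cv i]
            separated_realized_iff_gap[OF sep c tr' cv i] by auto
    qed
  next
    case False
    then show ?thesis using realized_subset_all[OF sep c] tr tr' by blast
  qed
  then show ?thesis by blast
qed

text \<open>Passing from \<open>E \<union> E'\<close> to its hull adds only sets that already lie
  between two realized ones, and \<open>YP\<close> is either present or enclosed by
  \<open>Y c\<close> and \<open>Y (Suc c)\<close>. So comparing generating sets of the hulls
  suffices.\<close>

lemma separated_join: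
  assumes sep: "separated n c b Y YP" and c: "c < n" and tr: "trace n c E P" "trace n c E' P'"
    and F: "F = chull (\<le>) (E \<union> E')" and Q: "Q \<longleftrightarrow> P \<or> P' \<or> (c \<in> F \<and> Suc c \<in> F)"
  shows "realized b Y YP F Q = chull (\<le>) (realized b Y YP E P \<union> realized b Y YP E' P')" (is "?l = ?r")
proof
  have EF: "E \<union> E' \<subseteq> F" unfolding F by (rule linorder_class.chull_subset)
  have b: "b = {}" using sep by (simp add: separated_def)
  show "?r \<subseteq> ?l"
  proof (rule chull_least)
    have "realized b Y YP E P \<subseteq> ?l" unfolding realized_def
      by (rule chull_mono) (use EF Q in auto)
    moreover have "realized b Y YP E' P' \<subseteq> ?l" unfolding realized_def
      by (rule chull_mono) (use EF Q in auto)
    ultimately show "realized b Y YP E P \<union> realized b Y YP E' P' \<subseteq> ?l" by simp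
  qed (rule order_convex_realized)
  have sub: "Y j \<subseteq> realized b Y YP E P" if "j \<in> E" for j E P
    using that chull_subset[of "b \<union> (\<Union>j\<in>E. Y j) \<union> (if P then YP else {})"] unfolding realized_def by blast
  have sub': "YP \<subseteq> realized b Y YP E P" if P for E P
    using that chull_subset[of "b \<union> (\<Union>j\<in>E. Y j) \<union> (if P then YP else {})"] unfolding realized_def by auto
  have r: "realized b Y YP E P \<subseteq> ?r" "realized b Y YP E' P' \<subseteq> ?r" by (rule subset_chull_Un)+
  have rY: "Y j \<subseteq> ?r" if "j \<in> E \<union> E'" for j using that sub r by blast
  have YF: "Y j \<subseteq> ?r" if jF: "j \<in> F" for j
  proof -
    obtain i k where ik: "i \<in> E \<union> E'" "k \<in> E \<union> E'" "i \<le> j" "j \<le> k" using jF unfolding F chull_nat_iff by blast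
    then have "k \<le> n" using tr by (auto simp: trace_def)
    show ?thesis
    proof (cases "i = j \<or> k = j")
      case True then show ?thesis using ik rY by blast
    next
      case False
      then have l: "lies_below (Y i) (Y j)" "lies_below (Y j) (Y k)"
        using separated_less[OF sep] ik \<open>k \<le> n\<close> by auto
      obtain v w where "v \<in> Y i" "w \<in> Y k"
        using sep ik \<open>k \<le> n\<close> unfolding separated_def by (meson all_not_in_conv le_trans)
      then have "Y j \<subseteq> chull (\<le>) (Y i \<union> Y k)" using l unfolding lies_below_def chull_def by (blast intro: less_imp_le)
      also have "\<dots> \<subseteq> ?r" using rY ik by (intro chull_least) auto
      finally show ?thesis .
    qed
  qed
  have "YP \<subseteq> ?r" if Q
  proof (cases "P \<or> P'")
    case True then show ?thesis using sub' r by blast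
  next
    case False
    then have "c \<in> F" "Suc c \<in> F" using that Q by auto
    then have "chull (\<le>) (Y c \<union> Y (Suc c)) \<subseteq> ?r" using YF by (intro chull_least) auto
    then show ?thesis using sep by (auto simp: separated_def)
  qed
  then show "?l \<subseteq> ?r" unfolding realized_def[of b Y YP F Q]
    using YF b by (intro chull_least) auto
qed

section \<open>Forcing arbitrary convex sets into one of the two shapes\<close>

lemma chull_Un_meeting:
  assumes "order_convex (\<le>) A" "order_convex (\<le>) B" "A \<inter> B \<noteq> {}"
  shows "chull (\<le>) (A \<union> B) = A \<union> B"
  using order_convex_Un[OF assms] by (simp add: order_convex_def)

text \<open>All the sets \<open>A\<close>, \<open>Q\<close>, \<open>C\<close> contain the nonempty
  set \<open>b0\<close>, and the hull of a union of two convex sets with a common point is the union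
  itself. Joins therefore become unions, and the computation takes place in a distributive lattice
  of sets.\<close>

lemma collapsed_of_overlap:
  assumes c: "c < n"
    and x: "\<And>j. order_convex (\<le>) (x j)" and q: "order_convex (\<le>) q" "x (Suc c) \<subseteq> q"
    and m: "order_convex (\<le>) m" "m \<noteq> {}"
    and V0: "V 0 = x 0" and Vn: "V n = x n" and VS: "\<And>k. k < n \<Longrightarrow> V (Suc k) \<subseteq> chull (\<le>) (V k \<union> x n)"
    and Vx: "\<And>j. j \<le> n \<Longrightarrow> V j \<subseteq> x j"
    and b0: "b0 = chull (\<le>) (m \<union> (\<Union>j\<in>{0<..<n}. chull (\<le>) (V j \<inter> chull (\<le>) (x 0 \<union> m) \<union> V j \<inter> chull (\<le>) (x n \<union> m))))"
    and b: "b = chull (\<le>) (chull (\<le>) (x 0 \<union> b0) \<inter> chull (\<le>) (q \<union> b0) \<union> chull (\<le>) (x 0 \<union> b0) \<inter> chull (\<le>) (x n \<union> b0))"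
    and Y: "\<And>j. Y j = chull (\<le>) (V j \<union> b)"
    and YP: "YP = chull (\<le>) (q \<union> b) \<inter> chull (\<le>) (Y c \<union> Y (Suc c))"
  shows "collapsed n c b Y YP"
proof -
  define A Q C where "A = chull (\<le>) (x 0 \<union> b0)" and "Q = chull (\<le>) (q \<union> b0)" and "C = chull (\<le>) (x n \<union> b0)"
  note sc = subset_chull_Un
  have mb0: "m \<subseteq> b0" unfolding b0 by (rule sc)
  have VH: "k \<le> n \<Longrightarrow> V k \<subseteq> chull (\<le>) (x 0 \<union> x n)" for k
  proof (induction k)
    case 0 then show ?case using V0 sc by simp
  next
    case (Suc k)
    then have "V k \<union> x n \<subseteq> chull (\<le>) (x 0 \<union> x n)" using sc by simp
    then have "chull (\<le>) (V k \<union> x n) \<subseteq> chull (\<le>) (x 0 \<union> x n)" by (intro chull_least) simp_all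
    then show ?case using VS[of k] Suc.prems by auto
  qed
  have Vb0: "V j \<subseteq> b0" if "0 < j" "j < n" for j
  proof -
    have ne: "chull (\<le>) (x 0 \<union> m) \<inter> chull (\<le>) (x n \<union> m) \<noteq> {}" using m(2) sc by blast
    \<comment> \<open>The hulls of \<open>m\<close> with either end share \<open>m\<close>, so their
      union is convex and covers everything between the ends. Consequently the two pieces of
      \<open>V j\<close> that are joined into \<open>b0\<close> exhaust \<open>V j\<close>.\<close>
    have "chull (\<le>) (x 0 \<union> x n) \<subseteq> chull (\<le>) (x 0 \<union> m) \<union> chull (\<le>) (x n \<union> m)"
      using sc by (intro chull_least order_convex_Un[OF _ _ ne]) (simp_all, blast+)
    then have "V j \<subseteq> V j \<inter> chull (\<le>) (x 0 \<union> m) \<union> V j \<inter> chull (\<le>) (x n \<union> m)" using VH[of j] that by auto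
    also have "\<dots> \<subseteq> chull (\<le>) (V j \<inter> chull (\<le>) (x 0 \<union> m) \<union> V j \<inter> chull (\<le>) (x n \<union> m))" by (rule chull_subset)
    also have "\<dots> \<subseteq> (\<Union>j\<in>{0<..<n}. chull (\<le>) (V j \<inter> chull (\<le>) (x 0 \<union> m) \<union> V j \<inter> chull (\<le>) (x n \<union> m)))"
      using that by (intro UN_upper) simp
    also have "\<dots> \<subseteq> b0" unfolding b0 by (rule sc)
    finally show ?thesis .
  qed
  have cvb0: "order_convex (\<le>) b0" by (simp add: b0)
  have cv: "order_convex (\<le>) A" "order_convex (\<le>) Q" "order_convex (\<le>) C" by (simp_all add: A_def Q_def C_def)
  have b0A: "b0 \<subseteq> A" "b0 \<subseteq> Q" "b0 \<subseteq> C" "x 0 \<subseteq> A" "q \<subseteq> Q" "x n \<subseteq> C" unfolding A_def Q_def C_def by (rule sc)+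
  have ne: "b0 \<noteq> {}" using mb0 m(2) by blast
  have b': "b = A \<inter> Q \<union> A \<inter> C"
  proof -
    have "A \<inter> Q \<inter> (A \<inter> C) \<noteq> {}" using b0A ne by blast
    then show ?thesis unfolding b A_def[symmetric] Q_def[symmetric] C_def[symmetric]
      using chull_Un_meeting order_convex_Int cv by simp
  qed
  have b0b: "b0 \<subseteq> b" using b0A b' by blast
  have cvb: "order_convex (\<le>) b" by (simp add: b)
  have Yj: "Y j = b" if "0 < j" "j < n" for j
  proof -
    have "V j \<union> b = b" using Vb0[OF that] b0b by blast
    then show ?thesis using cvb by (simp add: Y order_convex_def)
  qed
  have Y0: "Y 0 = A"
  proof
    show "Y 0 \<subseteq> A" unfolding Y V0 using b0A b' cv by (intro chull_least) auto
    show "A \<subseteq> Y 0" unfolding Y V0 A_def using b0b by (intro chull_mono) auto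
  qed
  have meet_b0: "S \<inter> T \<noteq> {}" if "b0 \<subseteq> S" "b0 \<subseteq> T" for S T using that ne by blast
  have Yn: "Y n = C \<union> b"
  proof
    show "Y n \<subseteq> C \<union> b" unfolding Y Vn
      using b0A b0b cv cvb meet_b0 by (intro chull_least order_convex_Un) auto
    have "C \<subseteq> Y n" unfolding Y Vn C_def using b0b by (intro chull_mono) auto
    then show "C \<union> b \<subseteq> Y n" unfolding Y using sc by auto
  qed
  have Qb: "chull (\<le>) (q \<union> b) \<subseteq> Q \<union> b"
    using b0A b0b cv cvb meet_b0 by (intro chull_least order_convex_Un) auto
  have Yc: "Y c \<subseteq> A" using c Y0 Yj[of c] b' by (cases "c = 0") auto
  \<comment> \<open>The part of \<open>Q\<close> inside \<open>A\<close> belongs to \<open>b\<close>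
    by construction. If \<open>Suc c\<close> is inner, nothing else occurs, since the hull stays in
    \<open>A\<close>; if \<open>Suc c = n\<close>, the remainder lies in \<open>C\<close>, which is
    part of \<open>Y n\<close>.\<close>
  have "YP \<subseteq> Y (Suc c)"
  proof (cases "Suc c = n")
    case False
    then have Ys: "Y (Suc c) = b" using Yj c by simp
    then have "chull (\<le>) (Y c \<union> Y (Suc c)) \<subseteq> A" using Yc b' cv by (intro chull_least) auto
    then have "YP \<subseteq> (Q \<union> b) \<inter> A" using Qb YP by blast
    then show ?thesis using Ys b' by blast
  next
    case True
    have "chull (\<le>) (Y c \<union> Y (Suc c)) \<subseteq> A \<union> C"
      using Yc Yn True b' b0A cv meet_b0 by (intro chull_least order_convex_Un) auto
    then have "YP \<subseteq> (Q \<union> b) \<inter> (A \<union> C)" using Qb YP by blast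
    then show ?thesis using Yn True b' by blast
  qed
  moreover have "b \<subseteq> Y 0" "b \<subseteq> Y n" "Y 0 \<inter> Y n = b" using Y0 Yn b' by auto
  ultimately show ?thesis unfolding collapsed_def using Yj by blast
qed

text \<open>A point of the hull outside both sets has a point of \<open>A\<close> below it and a
  point of \<open>B\<close> above it. Were it not beyond all of \<open>A\<close>, convexity would
  pull it into \<open>A\<close>; likewise for \<open>B\<close>.\<close>

lemma between_disjoint:
  assumes "lies_below A B" "order_convex (\<le>) A" "order_convex (\<le>) B" "A \<noteq> {}"
    "D \<subseteq> chull (\<le>) (A \<union> B)" "D \<inter> A = {}" "D \<inter> B = {}"
  shows "lies_below A D" "lies_below D B"
proof -
  have *: "\<exists>a\<in>A. \<exists>b\<in>B. a \<le> z \<and> z \<le> b" if z: "z \<in> D" for z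
  proof -
    have z': "z \<in> chull (\<le>) (A \<union> B)" "z \<notin> A" "z \<notin> B" using z assms by auto
    from z'(1) assms(2,3) show ?thesis
    proof (cases rule: mem_chull_Un_cases)
      case (4 a b)
      then have "a < b" using assms(1) by (auto simp: lies_below_def)
      then show ?thesis using 4 by (meson leD order_trans)
    qed (use z' in auto)
  qed
  show "lies_below A D" unfolding lies_below_def
  proof (intro ballI)
    fix a z assume az: "a \<in> A" "z \<in> D"
    obtain a' where "a' \<in> A" "a' \<le> z" using * az by blast
    then show "a < z" using order_convexD[OF assms(2), of a' a z] az assms(6) by (meson disjoint_iff not_le)
  qed
  show "lies_below D B" unfolding lies_below_def
  proof (intro ballI)
    fix z b' assume az: "b' \<in> B" "z \<in> D"
    obtain b where "b \<in> B" "z \<le> b" using * az by blast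
    then show "z < b'" using order_convexD[OF assms(3), of b' b z] az assms(7) by (meson disjoint_iff not_le)
  qed
qed

lemma subset_chull_between:
  "lies_below A D \<Longrightarrow> lies_below D B \<Longrightarrow> A \<noteq> {} \<Longrightarrow> B \<noteq> {} \<Longrightarrow> D \<subseteq> chull (\<le>) (A \<union> B)"
  unfolding lies_below_def chull_def by (blast intro: less_imp_le)

text \<open>The passage from \<open>x\<close> to \<open>W\<close> and \<open>V\<close> either leaves the sets \<open>W j\<close> in monotone order,
  or erases all the inner ones.\<close>

lemma separated_of_disjoint:
  assumes c: "c < n"
    and x: "\<And>j. order_convex (\<le>) (x j)" and q: "order_convex (\<le>) q" "x (Suc c) \<subseteq> q"
    and disj: "\<And>i j. i \<le> n \<Longrightarrow> j \<le> n \<Longrightarrow> i \<noteq> j \<Longrightarrow> x i \<inter> x j = {}"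
    and dq: "\<And>j. j \<le> n \<Longrightarrow> j \<noteq> Suc c \<Longrightarrow> q \<inter> x j = {}"
    and Wn: "W n = x n" and WS: "\<And>j. j < n \<Longrightarrow> W j = x j \<inter> chull (\<le>) (x 0 \<union> W (Suc j))"
    and V0: "V 0 = x 0" and VS: "\<And>k. k < n \<Longrightarrow> V (Suc k) = W (Suc k) \<inter> chull (\<le>) (V k \<union> x n)"
    and YP: "YP = q \<inter> chull (\<le>) (V c \<union> V (Suc c))"
    and ne: "x 0 \<noteq> {}" "\<And>j. 0 < j \<Longrightarrow> j \<le> n \<Longrightarrow> W j \<noteq> {}" and up: "lies_below (x 0) (x n)"
  shows "separated n c {} V YP"
proof -
  have Wx: "W j \<subseteq> x j" if "j \<le> n" for j using Wn WS[of j] that by (cases "j = n") auto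
  have cvW: "order_convex (\<le>) (W j)" if "j \<le> n" for j
    using Wn WS[of j] x that by (cases "j = n") (auto intro!: order_convex_Int)
  \<comment> \<open>Downward induction, as \<open>W j\<close> is cut out by
    \<open>W (Suc j)\<close>: being disjoint from \<open>x 0\<close> and from
    \<open>W (Suc j)\<close> but inside their hull, it must lie strictly between them.\<close>
  have W: "lies_below (x 0) (W j) \<and> (j < n \<longrightarrow> lies_below (W j) (W (Suc j)) \<and> lies_below (W j) (x n))"
    if "j \<le> n" "0 < j" for j
    using that
  proof (induction j rule: inc_induct)
    case base then show ?case using up Wn by simp
  next
    case (step j)
    have l: "lies_below (x 0) (W (Suc j))" using step by simp
    have s: "W j \<subseteq> chull (\<le>) (x 0 \<union> W (Suc j))" using WS step by simp
    have d: "W j \<inter> x 0 = {}" "W j \<inter> W (Suc j) = {}"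
      using Wx[of j] Wx[of "Suc j"] disj[of j 0] disj[of j "Suc j"] step by auto
    have *: "lies_below (x 0) (W j)" "lies_below (W j) (W (Suc j))"
      using between_disjoint[OF l x cvW ne(1) s d] step by auto
    have "lies_below (W j) (x n)"
    proof (cases "Suc j = n")
      case True then show ?thesis using * Wn by simp
    next
      case False
      then have "lies_below (W (Suc j)) (x n)" using step by simp
      then show ?thesis using lies_below_trans[OF *(2)] ne(2)[of "Suc j"] step by simp
    qed
    then show ?case using * by simp
  qed
  have nex: "x n \<noteq> {}" using ne Wn c by (metis gr_implies_not0 gr0I le_refl)
  \<comment> \<open>The upward pass removes nothing here: \<open>W (Suc k)\<close> is already
    between \<open>V k\<close> and \<open>x n\<close>.\<close>
  have VW: "k \<le> n \<Longrightarrow> V k = (if k = 0 then x 0 else W k)" for k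
  proof (induction k)
    case 0 then show ?case by (simp add: V0)
  next
    case (Suc k)
    have "W (Suc k) \<subseteq> chull (\<le>) (V k \<union> x n)"
    proof (cases "Suc k = n")
      case True then show ?thesis using Wn subset_chull_Un by simp
    next
      case False
      then have "lies_below (W (Suc k)) (x n)" using W[of "Suc k"] Suc.prems by simp
      moreover have "lies_below (V k) (W (Suc k))" using Suc W[of "Suc k"] W[of k] by (cases "k = 0") auto
      moreover have "V k \<noteq> {}" using Suc ne by (cases "k = 0") auto
      ultimately show ?thesis using nex by (intro subset_chull_between)
    qed
    then show ?case using VS[of k] Suc.prems by auto
  qed
  have Vne: "V k \<noteq> {}" if "k \<le> n" for k using VW[OF that] ne that by simp
  have Vlt: "lies_below (V k) (V (Suc k))" if "k < n" for k
    using VW[of k] VW[of "Suc k"] W[of "Suc k"] W[of k] that by (cases "k = 0") simp_all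
  have Vx: "V k \<subseteq> x k" if "k \<le> n" for k using VW[OF that] Wx[OF that] by simp
  have "V (Suc c) \<subseteq> YP" using Vx[of "Suc c"] c q(2) subset_chull_Un unfolding YP by auto
  moreover have "YP \<inter> V c = {}" using dq[of c] Vx[of c] c unfolding YP by auto
  ultimately show ?thesis unfolding separated_def using Vne Vlt YP by simp
qed

text \<open>If some \<open>W k\<close> is empty, so is \<open>W j\<close> for all smaller
  \<open>j > 0\<close>, because \<open>W j\<close> shrinks to \<open>x j \<inter> x 0\<close>. Then
  \<open>V 1\<close> is empty, unless \<open>n = 1\<close> and there is no inner index, and the
  upward pass spreads this to all inner \<open>V j\<close>, which shrink into
  \<open>x j \<inter> x n\<close>. An empty \<open>x 0\<close> starts the second pass
  directly.\<close>

lemma collapsed_of_disjoint: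
  assumes c: "c < n"
    and x: "\<And>j. order_convex (\<le>) (x j)" and q: "order_convex (\<le>) q" "x (Suc c) \<subseteq> q"
    and disj: "\<And>i j. i \<le> n \<Longrightarrow> j \<le> n \<Longrightarrow> i \<noteq> j \<Longrightarrow> x i \<inter> x j = {}"
    and dq: "\<And>j. j \<le> n \<Longrightarrow> j \<noteq> Suc c \<Longrightarrow> q \<inter> x j = {}"
    and Wn: "W n = x n" and WS: "\<And>j. j < n \<Longrightarrow> W j = x j \<inter> chull (\<le>) (x 0 \<union> W (Suc j))"
    and V0: "V 0 = x 0" and VS: "\<And>k. k < n \<Longrightarrow> V (Suc k) = W (Suc k) \<inter> chull (\<le>) (V k \<union> x n)"
    and YP: "YP = q \<inter> chull (\<le>) (V c \<union> V (Suc c))"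
    and no: "\<not> (x 0 \<noteq> {} \<and> (\<forall>j. 0 < j \<and> j \<le> n \<longrightarrow> W j \<noteq> {}))"
  shows "collapsed n c {} V YP"
proof -
  have Wx: "W j \<subseteq> x j" if "j \<le> n" for j using Wn WS[of j] that by (cases "j = n") auto
  have h: "chull (\<le>) (x j) = x j" for j using x by (simp add: order_convex_def)
  have Vn: "V n = x n" using VS[of "n - 1"] c Wn subset_chull_Un(2)[of "x n" "V (n - 1)"] by auto
  have Wdown: "W j = {}" if "W k = {}" "0 < j" "j \<le> k" "k \<le> n" for j k
    using that(3,2,1,4)
  proof (induction j rule: inc_induct)
    case (step j)
    then have "W j = x j \<inter> x 0" using WS[of j] h by simp
    then show ?case using disj[of j 0] step by simp
  qed simp
  have V1: "n = 1 \<or> V 1 = {}"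
  proof (cases "x 0 = {}")
    case True
    have "V 1 \<subseteq> x 1 \<inter> x n" using VS[of 0] c V0 True h Wx[of 1] by auto
    then show ?thesis using disj[of 1 n] c by auto
  next
    case False
    then obtain k where k: "0 < k" "k \<le> n" "W k = {}" using no by blast
    then have "W 1 = {}" using Wdown[of k 1] by simp
    then show ?thesis using VS[of 0] c by simp
  qed
  have Vj: "V j = {}" if "0 < j" "j < n" for j
    using that
  proof (induction j)
    case (Suc j)
    show ?case
    proof (cases "j = 0")
      case True then show ?thesis using V1 Suc.prems by simp
    next
      case False
      then have "V (Suc j) = W (Suc j) \<inter> x n" using VS[of j] Suc h by simp
      then show ?thesis using Wx[of "Suc j"] disj[of "Suc j" n] Suc.prems by auto
    qed
  qed simp
  have Vx: "V j \<subseteq> x j" if "j \<le> n" for j using that V0 Vn Vj[of j] by (cases "j = 0"; cases "j = n") auto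
  have V0n: "V 0 \<inter> V n = {}" using V0 Vn disj[of 0 n] c by simp
  have qc: "q \<inter> x c = {}" using dq[of c] c by simp
  \<comment> \<open>With one of the two sets empty, the hull that defines \<open>YP\<close> is just
    the other one. Intersected with \<open>q\<close>, the set \<open>V c\<close> disappears, and
    \<open>V (Suc c)\<close> is where \<open>YP\<close> should be.\<close>
  have *: "V c = {} \<or> V (Suc c) = {}"
  proof (cases "n = 1")
    case False
    then show ?thesis using Vj[of c] Vj[of "Suc c"] c by (cases "c = 0") auto
  next
    case True
    then show ?thesis using no Wn V0 Vn c by (auto simp: le_Suc_eq)
  qed
  have hV: "chull (\<le>) (V j) = V j" if "j \<le> n" for j
    using that V0 Vn Vj[of j] h by (cases "j = 0"; cases "j = n") auto
  have "YP \<subseteq> V (Suc c)"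
    using * hV[of c] hV[of "Suc c"] c Vx[of c] qc unfolding YP by auto
  then show ?thesis unfolding collapsed_def using V0n Vj by simp
qed

end

section \<open>Lattice terms\<close>

datatype trm = Var nat | Join trm trm | Meet trm trm

primrec co_eval :: "('a \<Rightarrow> 'a \<Rightarrow> bool) \<Rightarrow> (nat \<Rightarrow> 'a set) \<Rightarrow> trm \<Rightarrow> 'a set" where
  "co_eval r x (Var i) = x i"
| "co_eval r x (Join s t) = chull r (co_eval r x s \<union> co_eval r x t)"
| "co_eval r x (Meet s t) = co_eval r x s \<inter> co_eval r x t"

text \<open>\<open>Var j\<close> with \<open>j \<le> n\<close> stands for the \<open>j\<close>-th atom and \<open>Var (Suc n)\<close> for \<open>p\<close>. The term
  \<open>left_trm n k\<close> shrinks the atom \<open>n - k\<close>, whereas \<open>right_trm n k\<close> shrinks the atom \<open>k\<close>. The term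
  \<open>bot_trm\<close> is the bottom unless two atoms overlap; then it absorbs everything that has to
  collapse.\<close>

definition pre_apex_trm :: "nat \<Rightarrow> nat \<Rightarrow> trm" where
  "pre_apex_trm n c = Join (Var (Suc n)) (Var (Suc c))"

text \<open>The start value of the fold replaces the missing constant for the bottom. For
  \<open>n > 0\<close> it is itself one of the pairwise meets, so it introduces no further
  overlap.\<close>

definition overlap_trm :: "nat \<Rightarrow> nat \<Rightarrow> trm" where
  "overlap_trm n c = foldr Join
     (concat (map (\<lambda>i. map (\<lambda>j. Meet (Var i) (Var j)) (filter (\<lambda>j. j \<noteq> i) [0..<Suc n])) [0..<Suc n])
      @ map (\<lambda>j. Meet (pre_apex_trm n c) (Var j)) (filter (\<lambda>j. j \<noteq> Suc c) [0..<Suc n]))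
     (Meet (Var 0) (Var n))"

primrec left_trm :: "nat \<Rightarrow> nat \<Rightarrow> trm" where
  "left_trm n 0 = Var n"
| "left_trm n (Suc k) = Meet (Var (n - Suc k)) (Join (Var 0) (left_trm n k))"

primrec right_trm :: "nat \<Rightarrow> nat \<Rightarrow> trm" where
  "right_trm n 0 = Var 0"
| "right_trm n (Suc k) = Meet (left_trm n (n - Suc k)) (Join (right_trm n k) (Var n))"

text \<open>A switch: both meets are empty in the disjoint case, but as soon as
  \<open>overlap_trm\<close> has a point, they jointly yield the whole of
  \<open>right_trm n j\<close>, because the two joins then cover everything between the end
  atoms.\<close>

definition inner_trm :: "nat \<Rightarrow> nat \<Rightarrow> trm" where
  "inner_trm n c = foldr Join
     (map (\<lambda>j. Join (Meet (right_trm n j) (Join (Var 0) (overlap_trm n c)))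
                    (Meet (right_trm n j) (Join (Var n) (overlap_trm n c)))) [1..<n])
     (overlap_trm n c)"

text \<open>The second meet makes the two end atoms intersect exactly in the bottom; the first
  absorbs what \<open>p\<close> shares with the left end, so that \<open>apex_trm\<close> drops into
  the atom \<open>Suc c\<close>.\<close>

definition bot_trm :: "nat \<Rightarrow> nat \<Rightarrow> trm" where
  "bot_trm n c = Join
     (Meet (Join (Var 0) (inner_trm n c)) (Join (pre_apex_trm n c) (inner_trm n c)))
     (Meet (Join (Var 0) (inner_trm n c)) (Join (Var n) (inner_trm n c)))"

definition atom_trm :: "nat \<Rightarrow> nat \<Rightarrow> nat \<Rightarrow> trm" where
  "atom_trm n c j = Join (right_trm n j) (bot_trm n c)"

definition apex_trm :: "nat \<Rightarrow> nat \<Rightarrow> trm" where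
  "apex_trm n c = Meet (Join (pre_apex_trm n c) (bot_trm n c)) (Join (atom_trm n c c) (atom_trm n c (Suc c)))"

definition elem_trm :: "nat \<Rightarrow> nat \<Rightarrow> nat set \<Rightarrow> bool \<Rightarrow> trm" where
  "elem_trm n c E P = foldr Join
     (map (atom_trm n c) (filter (\<lambda>j. j \<in> E) [0..<Suc n]) @ (if P then [apex_trm n c] else []))
     (bot_trm n c)"

section \<open>Values of the terms at convex sets\<close>

lemma co_eval_dual: "co_eval (\<lambda>x y. r y x) = co_eval r"
proof (intro ext)
  show "co_eval (\<lambda>x y. r y x) x t = co_eval r x t" for x t
    by (induction t) (simp_all add: chull_dual[of r])
qed

context linorder
begin

lemma order_convex_co_eval:
  assumes "\<forall>j. order_convex (\<le>) (x j)"
  shows "order_convex (\<le>) (co_eval (\<le>) x t)"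
  using assms by (induction t) (simp_all add: order_convex_Int)

lemma co_eval_foldr_Join:
  assumes "\<forall>j. order_convex (\<le>) (x j)"
  shows "co_eval (\<le>) x (foldr Join ts t) = chull (\<le>) (co_eval (\<le>) x t \<union> (\<Union>s\<in>set ts. co_eval (\<le>) x s))"
proof (induction ts)
  case Nil
  then show ?case using order_convex_co_eval[OF assms] by (simp add: order_convex_def)
next
  case (Cons s ts)
  then show ?case by (simp add: chull_Un_chull Un_ac)
qed

lemma co_eval_elem_trm:
  assumes "\<forall>j. order_convex (\<le>) (x j)" "E \<subseteq> {..n}"
  shows "co_eval (\<le>) x (elem_trm n c E P) =
    realized (co_eval (\<le>) x (bot_trm n c)) (\<lambda>j. co_eval (\<le>) x (atom_trm n c j)) (co_eval (\<le>) x (apex_trm n c)) E P"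
proof -
  have "set (filter (\<lambda>j. j \<in> E) [0..<Suc n]) = E"
    using assms(2) by (auto simp: less_Suc_eq_le simp del: upt_Suc)
  then show ?thesis unfolding elem_trm_def realized_def co_eval_foldr_Join[OF assms(1)]
    by (cases P) (simp_all del: upt_Suc set_filter add: Un_ac)
qed

lemma chull_eq_empty_iff: "chull (\<le>) A = {} \<longleftrightarrow> A = {}"
  using chull_subset by auto

lemma overlap_trm_empty_iff:
  assumes x: "\<forall>j. order_convex (\<le>) (x j)" and c: "c < n"
  shows "co_eval (\<le>) x (overlap_trm n c) = {} \<longleftrightarrow>
    (\<forall>i\<le>n. \<forall>j\<le>n. i \<noteq> j \<longrightarrow> x i \<inter> x j = {}) \<and>
    (\<forall>j\<le>n. j \<noteq> Suc c \<longrightarrow> co_eval (\<le>) x (pre_apex_trm n c) \<inter> x j = {})"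
proof -
  have s: "{0..<Suc n} = {..n}" by auto
  have "co_eval (\<le>) x (overlap_trm n c) = {} \<longleftrightarrow>
    x 0 \<inter> x n = {} \<and> (\<forall>i\<in>{0..<Suc n}. \<forall>j\<in>{j \<in> {0..<Suc n}. j \<noteq> i}. x i \<inter> x j = {}) \<and>
    (\<forall>j\<in>{j \<in> {0..<Suc n}. j \<noteq> Suc c}. co_eval (\<le>) x (pre_apex_trm n c) \<inter> x j = {})"
    unfolding overlap_trm_def co_eval_foldr_Join[OF x] chull_eq_empty_iff
    by (simp del: upt_Suc) blast
  also have "\<dots> \<longleftrightarrow> (\<forall>i\<le>n. \<forall>j\<le>n. i \<noteq> j \<longrightarrow> x i \<inter> x j = {}) \<and>
    (\<forall>j\<le>n. j \<noteq> Suc c \<longrightarrow> co_eval (\<le>) x (pre_apex_trm n c) \<inter> x j = {})"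
    unfolding s using c by auto
  finally show ?thesis .
qed

lemma right_trm_subset:
  assumes "j \<le> n"
  shows "co_eval (\<le>) x (right_trm n j) \<subseteq> x j"
proof -
  have "co_eval (\<le>) x (left_trm n (n - j)) \<subseteq> x j"
  proof (cases "j = n")
    case False
    then have "n - j = Suc (n - Suc j)" using assms by simp
    then show ?thesis using assms by simp
  qed simp
  then show ?thesis by (cases j) auto
qed

text \<open>Without overlaps every meet in \<open>inner_trm\<close> and \<open>bot_trm\<close>
  reduces to an intersection of two disjoint arguments, since \<open>right_trm n j\<close> stays
  inside the atom \<open>j\<close>.\<close>

lemma bot_trm_empty:
  assumes c: "c < n" and x: "\<forall>j. order_convex (\<le>) (x j)" and m: "co_eval (\<le>) x (overlap_trm n c) = {}"
  shows "co_eval (\<le>) x (bot_trm n c) = {}"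
proof -
  define q where "q = co_eval (\<le>) x (pre_apex_trm n c)"
  note D = iffD1[OF overlap_trm_empty_iff[OF x c] m]
  have dj: "x i \<inter> x j = {}" if "i \<le> n" "j \<le> n" "i \<noteq> j" for i j
    using conjunct1[OF D] that by blast
  have dq: "q \<inter> x j = {}" if "j \<le> n" "j \<noteq> Suc c" for j
    using conjunct2[OF D] that unfolding q_def by blast
  have h: "chull (\<le>) (x j) = x j" "chull (\<le>) q = q" for j
    using x order_convex_co_eval[OF x] by (simp_all add: order_convex_def q_def)
  have "co_eval (\<le>) x (right_trm n j) \<inter> x 0 = {}" "co_eval (\<le>) x (right_trm n j) \<inter> x n = {}" if "0 < j" "j < n" for j
    using right_trm_subset[of j n x] dj[of j 0] dj[of j n] that by auto
  then have "co_eval (\<le>) x (inner_trm n c) = {}"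
    unfolding inner_trm_def co_eval_foldr_Join[OF x] m by (simp add: h m)
  then show ?thesis
    using dj[of 0 n] dq[of 0] c by (simp add: bot_trm_def h q_def[symmetric] Int_commute)
qed

text \<open>The middle alternative is the wanted arrangement read from right to left. It is left
  open here and settled by reversing the order.\<close>

lemma terms_cases:
  assumes c: "c < n" and x: "\<forall>j. order_convex (\<le>) (x j)"
  defines "b \<equiv> co_eval (\<le>) x (bot_trm n c)" and "Y \<equiv> \<lambda>j. co_eval (\<le>) x (atom_trm n c j)"
    and "YP \<equiv> co_eval (\<le>) x (apex_trm n c)"
  shows "collapsed n c b Y YP \<or> (lies_below (x n) (x 0) \<and> x 0 \<noteq> {} \<and> x n \<noteq> {}) \<or> separated n c b Y YP"
proof -
  \<comment> \<open>\<open>left_trm\<close> counts its steps from the right end; \<open>W\<close> is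
    indexed by the atom that is being shrunk.\<close>
  define q m V W where "q = co_eval (\<le>) x (pre_apex_trm n c)" and "m = co_eval (\<le>) x (overlap_trm n c)"
    and "V = (\<lambda>j. co_eval (\<le>) x (right_trm n j))" and "W = (\<lambda>j. co_eval (\<le>) x (left_trm n (n - j)))"
  define b0 where "b0 = co_eval (\<le>) x (inner_trm n c)"
  \<comment> \<open>Arbitrary values of the variables need not respect that \<open>p\<close> lies
    above the atom \<open>Suc c\<close>; the join in \<open>pre_apex_trm\<close> enforces
    it.\<close>
  have q: "order_convex (\<le>) q" "x (Suc c) \<subseteq> q"
    unfolding q_def pre_apex_trm_def using subset_chull_Un by simp_all
  have m: "order_convex (\<le>) m" unfolding m_def by (rule order_convex_co_eval[OF x])
  have Wn: "W n = x n" by (simp add: W_def)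
  have WS: "W j = x j \<inter> chull (\<le>) (x 0 \<union> W (Suc j))" if "j < n" for j
  proof -
    have "n - j = Suc (n - Suc j)" using that by simp
    then show ?thesis using that by (simp add: W_def)
  qed
  have V0: "V 0 = x 0" by (simp add: V_def)
  have VS: "V (Suc k) = W (Suc k) \<inter> chull (\<le>) (V k \<union> x n)" if "k < n" for k
    by (simp add: V_def W_def)
  have Vx: "V j \<subseteq> x j" if "j \<le> n" for j using right_trm_subset[OF that] by (simp add: V_def)
  have Vn: "V n = x n" using VS[of "n - 1"] c Wn subset_chull_Un(2)[of "x n" "V (n - 1)"] by auto
  have i: "set [1..<n] = {0<..<n}" by auto
  have b0: "b0 = chull (\<le>) (m \<union> (\<Union>j\<in>{0<..<n}. chull (\<le>) (V j \<inter> chull (\<le>) (x 0 \<union> m) \<union> V j \<inter> chull (\<le>) (x n \<union> m))))"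
    unfolding b0_def inner_trm_def co_eval_foldr_Join[OF x] set_map i image_image m_def V_def by simp
  have b: "b = chull (\<le>) (chull (\<le>) (x 0 \<union> b0) \<inter> chull (\<le>) (q \<union> b0) \<union> chull (\<le>) (x 0 \<union> b0) \<inter> chull (\<le>) (x n \<union> b0))"
    unfolding b_def bot_trm_def b0_def q_def by simp
  have Y: "Y j = chull (\<le>) (V j \<union> b)" for j by (simp add: Y_def atom_trm_def V_def b_def)
  have YP: "YP = chull (\<le>) (q \<union> b) \<inter> chull (\<le>) (Y c \<union> Y (Suc c))"
    by (simp add: YP_def apex_trm_def Y_def q_def b_def)
  show ?thesis
  proof (cases "m = {}")
    case False
    have "V (Suc k) \<subseteq> chull (\<le>) (V k \<union> x n)" if "k < n" for k using VS[OF that] by simp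
    from collapsed_of_overlap[OF c x[rule_format] q m False V0 Vn this Vx b0 b Y YP]
    show ?thesis by simp
  next
    case True
    note D = iffD1[OF overlap_trm_empty_iff[OF x c] True[unfolded m_def]]
    have dj: "x i \<inter> x j = {}" if "i \<le> n" "j \<le> n" "i \<noteq> j" for i j
      using conjunct1[OF D] that by blast
    have dq: "q \<inter> x j = {}" if "j \<le> n" "j \<noteq> Suc c" for j
      using conjunct2[OF D] that unfolding q_def by blast
    have h: "chull (\<le>) (x j) = x j" "chull (\<le>) q = q" "chull (\<le>) (V j) = V j" for j
      using x q(1) order_convex_co_eval[OF x] by (simp_all add: order_convex_def V_def)
    have b': "b = {}" unfolding b_def using bot_trm_empty[OF c x] True by (simp add: m_def)
    have Y': "Y = V" using Y b' h by auto
    have YP': "YP = q \<inter> chull (\<le>) (V c \<union> V (Suc c))" using YP b' Y' h by simp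
    consider "\<not> (x 0 \<noteq> {} \<and> (\<forall>j. 0 < j \<and> j \<le> n \<longrightarrow> W j \<noteq> {}))"
      | "x 0 \<noteq> {}" "\<forall>j. 0 < j \<and> j \<le> n \<longrightarrow> W j \<noteq> {}" "lies_below (x 0) (x n)"
      | "x 0 \<noteq> {}" "\<forall>j. 0 < j \<and> j \<le> n \<longrightarrow> W j \<noteq> {}" "lies_below (x n) (x 0)"
      using lies_below_cases[OF x[rule_format, of 0] x[rule_format, of n]] dj[of 0 n] c by blast
    then show ?thesis
    proof cases
      case 1
      from collapsed_of_disjoint[OF c x[rule_format] q dj dq Wn WS V0 VS YP' 1] show ?thesis using Y' b' by simp
    next
      case 2
      from separated_of_disjoint[OF c x[rule_format] q dj dq Wn WS V0 VS YP' 2(1) _ 2(3)] 2(2) show ?thesis using Y' b' by simp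
    next
      case 3
      then show ?thesis using Wn c by auto
    qed
  qed
qed

lemma elem_trm_hom_unless_reversed:
  assumes c: "c < n" and x: "\<forall>j. order_convex (\<le>) (x j)"
    and tr: "trace n c E P" "trace n c E' P'"
    and F: "F = chull (\<le>) (E \<union> E')" and Q: "Q \<longleftrightarrow> P \<or> P' \<or> (c \<in> F \<and> Suc c \<in> F)"
    and no: "\<not> (lies_below (x n) (x 0) \<and> x 0 \<noteq> {} \<and> x n \<noteq> {})"
  shows "co_eval (\<le>) x (elem_trm n c (E \<inter> E') (P \<and> P')) =
      co_eval (\<le>) x (elem_trm n c E P) \<inter> co_eval (\<le>) x (elem_trm n c E' P') \<and>
    co_eval (\<le>) x (elem_trm n c F Q) =
      chull (\<le>) (co_eval (\<le>) x (elem_trm n c E P) \<union> co_eval (\<le>) x (elem_trm n c E' P'))"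
proof -
  have E: "E \<subseteq> {..n}" "E' \<subseteq> {..n}" "E \<inter> E' \<subseteq> {..n}" using tr by (auto simp: trace_def)
  then have F': "F \<subseteq> {..n}" unfolding F by (fastforce simp: chull_nat_iff)
  note cv = order_convex_co_eval[OF x]
  consider "collapsed n c (co_eval (\<le>) x (bot_trm n c)) (\<lambda>j. co_eval (\<le>) x (atom_trm n c j)) (co_eval (\<le>) x (apex_trm n c))"
    | "separated n c (co_eval (\<le>) x (bot_trm n c)) (\<lambda>j. co_eval (\<le>) x (atom_trm n c j)) (co_eval (\<le>) x (apex_trm n c))"
    using terms_cases[OF c x] no by blast
  then show ?thesis
  proof cases
    case 1
    show ?thesis
      unfolding co_eval_elem_trm[OF x E(1)] co_eval_elem_trm[OF x E(2)] co_eval_elem_trm[OF x E(3)]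
        co_eval_elem_trm[OF x F']
      using collapsed_meet[OF 1 c tr cv cv cv] collapsed_join[OF 1 c tr F Q] by (rule conjI)
  next
    case 2
    show ?thesis
      unfolding co_eval_elem_trm[OF x E(1)] co_eval_elem_trm[OF x E(2)] co_eval_elem_trm[OF x E(3)]
        co_eval_elem_trm[OF x F']
      using separated_meet[OF 2 c tr cv cv] separated_join[OF 2 c tr F Q] by (rule conjI)
  qed
qed

end

text \<open>Hulls, convexity and hence values of terms are the same for an order and its dual. If
  the last set lies below the first one, both being nonempty, the dual order is free of this
  defect.\<close>

lemma elem_trm_hom:
  assumes lin: "class.linorder r lt" and c: "c < n" and x: "\<forall>j. order_convex r (x j)"
    and tr: "trace n c E P" "trace n c E' P'"
    and F: "F = chull (\<le>) (E \<union> E')" and Q: "Q \<longleftrightarrow> P \<or> P' \<or> (c \<in> F \<and> Suc c \<in> F)"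
  shows "co_eval r x (elem_trm n c (E \<inter> E') (P \<and> P')) =
      co_eval r x (elem_trm n c E P) \<inter> co_eval r x (elem_trm n c E' P') \<and>
    co_eval r x (elem_trm n c F Q) =
      chull r (co_eval r x (elem_trm n c E P) \<union> co_eval r x (elem_trm n c E' P'))"
proof (cases "linorder.lies_below lt (x n) (x 0) \<and> x 0 \<noteq> {} \<and> x n \<noteq> {}")
  case False
  then show ?thesis using linorder.elem_trm_hom_unless_reversed[OF lin c x tr F Q] by blast
next
  case True
  have dual: "class.linorder (\<lambda>x y. r y x) (\<lambda>x y. lt y x)"
    by (rule linorder.dual_linorder[OF lin])
  have "\<not> (linorder.lies_below (\<lambda>x y. lt y x) (x n) (x 0) \<and> x 0 \<noteq> {} \<and> x n \<noteq> {})"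
    using True linorder.lies_below_asym[OF lin] linorder.lies_below_def[OF lin, of "x 0"]
      linorder.lies_below_def[OF dual, of "x n"] by blast
  with linorder.elem_trm_hom_unless_reversed[OF dual c, of x E P E' P' F Q] x tr F Q
  show ?thesis by (simp add: co_eval_dual[of r] chull_dual[of r] order_convex_dual[of r])
qed

section \<open>Coordinates in chains\<close>

lemma (in lattice) join_equality:
  assumes "x \<in> carrier L" "y \<in> carrier L" "s \<in> carrier L" "x \<sqsubseteq> s" "y \<sqsubseteq> s"
    and "\<And>w. w \<in> carrier L \<Longrightarrow> x \<sqsubseteq> w \<Longrightarrow> y \<sqsubseteq> w \<Longrightarrow> s \<sqsubseteq> w"
  shows "x \<squnion> y = s"
proof (rule le_antisym)
  show "x \<squnion> y \<sqsubseteq> s" using assms by (intro join_le)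
  show "s \<sqsubseteq> x \<squnion> y" using assms join_left join_right by (intro assms(6)) auto
qed (use assms in auto)

lemma (in lattice) meet_equality:
  assumes "x \<in> carrier L" "y \<in> carrier L" "s \<in> carrier L" "s \<sqsubseteq> x" "s \<sqsubseteq> y"
    and "\<And>w. w \<in> carrier L \<Longrightarrow> w \<sqsubseteq> x \<Longrightarrow> w \<sqsubseteq> y \<Longrightarrow> w \<sqsubseteq> s"
  shows "x \<sqinter> y = s"
proof (rule le_antisym)
  show "s \<sqsubseteq> x \<sqinter> y" using assms by (intro meet_le)
  show "x \<sqinter> y \<sqsubseteq> s" using assms meet_left meet_right by (intro assms(6)) auto
qed (use assms in auto)

text \<open>A homomorphism into the convex sets of an order on a whole type, without a carrier for
  the chain, so that the facts proved in \<open>linorder\<close> apply directly.\<close>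

definition co_hom :: "('t \<Rightarrow> 't \<Rightarrow> bool) \<Rightarrow> 'a gorder \<Rightarrow> ('a \<Rightarrow> 't set) \<Rightarrow> bool" where
  "co_hom r L \<phi> \<longleftrightarrow> (\<forall>s\<in>carrier L. order_convex r (\<phi> s)) \<and>
    (\<forall>s\<in>carrier L. \<forall>t\<in>carrier L. \<phi> (s \<squnion>\<^bsub>L\<^esub> t) = chull r (\<phi> s \<union> \<phi> t) \<and> \<phi> (s \<sqinter>\<^bsub>L\<^esub> t) = \<phi> s \<inter> \<phi> t)"

lemma lattice_prod_join_meet:
  assumes L: "\<And>i. i \<in> I \<Longrightarrow> lattice (L i)" and f: "f \<in> carrier (lattice_prod I L)" "g \<in> carrier (lattice_prod I L)" and i: "i \<in> I"
  shows "(f \<squnion>\<^bsub>lattice_prod I L\<^esub> g) i = f i \<squnion>\<^bsub>L i\<^esub> g i" "(f \<sqinter>\<^bsub>lattice_prod I L\<^esub> g) i = f i \<sqinter>\<^bsub>L i\<^esub> g i"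
proof -
  interpret P: lattice "lattice_prod I L" by (rule lattice_lattice_prod[OF L])
  have car: "x \<in> carrier (lattice_prod I L) \<longleftrightarrow> x \<in> extensional I \<and> (\<forall>i\<in>I. x i \<in> carrier (L i))" for x
    by (auto simp: lattice_prod_def PiE_iff)
  have le: "x \<sqsubseteq>\<^bsub>lattice_prod I L\<^esub> y \<longleftrightarrow> (\<forall>i\<in>I. x i \<sqsubseteq>\<^bsub>L i\<^esub> y i)" for x y
    by (simp add: lattice_prod_def)
  have fg: "f i \<in> carrier (L i)" "g i \<in> carrier (L i)" if "i \<in> I" for i using f that by (simp_all add: car)
  have J: "f i \<squnion>\<^bsub>L i\<^esub> g i \<in> carrier (L i) \<and> f i \<sqsubseteq>\<^bsub>L i\<^esub> f i \<squnion>\<^bsub>L i\<^esub> g i \<and> g i \<sqsubseteq>\<^bsub>L i\<^esub> f i \<squnion>\<^bsub>L i\<^esub> g i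
      \<and> (\<forall>w\<in>carrier (L i). f i \<sqsubseteq>\<^bsub>L i\<^esub> w \<longrightarrow> g i \<sqsubseteq>\<^bsub>L i\<^esub> w \<longrightarrow> f i \<squnion>\<^bsub>L i\<^esub> g i \<sqsubseteq>\<^bsub>L i\<^esub> w)" if "i \<in> I" for i
  proof -
    interpret lattice "L i" by (rule L[OF that])
    show ?thesis using fg[OF that] join_left join_right join_le by auto
  qed
  have M: "f i \<sqinter>\<^bsub>L i\<^esub> g i \<in> carrier (L i) \<and> f i \<sqinter>\<^bsub>L i\<^esub> g i \<sqsubseteq>\<^bsub>L i\<^esub> f i \<and> f i \<sqinter>\<^bsub>L i\<^esub> g i \<sqsubseteq>\<^bsub>L i\<^esub> g i
      \<and> (\<forall>w\<in>carrier (L i). w \<sqsubseteq>\<^bsub>L i\<^esub> f i \<longrightarrow> w \<sqsubseteq>\<^bsub>L i\<^esub> g i \<longrightarrow> w \<sqsubseteq>\<^bsub>L i\<^esub> f i \<sqinter>\<^bsub>L i\<^esub> g i)" if "i \<in> I" for i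
  proof -
    interpret lattice "L i" by (rule L[OF that])
    show ?thesis using fg[OF that] meet_left meet_right meet_le by auto
  qed
  have "f \<squnion>\<^bsub>lattice_prod I L\<^esub> g = (\<lambda>i\<in>I. f i \<squnion>\<^bsub>L i\<^esub> g i)"
    using J by (intro P.join_equality f) (simp_all add: car le)
  then show "(f \<squnion>\<^bsub>lattice_prod I L\<^esub> g) i = f i \<squnion>\<^bsub>L i\<^esub> g i" using i by simp
  have "f \<sqinter>\<^bsub>lattice_prod I L\<^esub> g = (\<lambda>i\<in>I. f i \<sqinter>\<^bsub>L i\<^esub> g i)"
    using M by (intro P.meet_equality f) (simp_all add: car le)
  then show "(f \<sqinter>\<^bsub>lattice_prod I L\<^esub> g) i = f i \<sqinter>\<^bsub>L i\<^esub> g i" using i by simp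
qed

text \<open>Placing all points outside the carrier above it makes the chain a linear order of the whole
  type with the same convex subsets of the carrier.\<close>

lemma total_order_extension:
  fixes T :: "'t gorder"
  assumes "total_order T"
  obtains r lt where "class.linorder r lt"
    "\<And>X. X \<in> carrier (Co T) \<Longrightarrow> order_convex r X"
    "\<And>X Y. X \<in> carrier (Co T) \<Longrightarrow> Y \<in> carrier (Co T) \<Longrightarrow>
      X \<squnion>\<^bsub>Co T\<^esub> Y = chull r (X \<union> Y) \<and> X \<sqinter>\<^bsub>Co T\<^esub> Y = X \<inter> Y"
proof -
  interpret T: total_order T by (rule assms)
  interpret C: lattice "Co T" by (rule lattice_Co)
  \<comment> \<open>The type need not carry a linear order; a well-order supplies one for the points
    outside the carrier.\<close>
  obtain w0 where "well_order_on (UNIV :: 't set) w0" using well_order_on by blast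
  then have w0: "linear_order w0" unfolding well_order_on_def by blast
  have "refl w0" "trans w0" "antisym w0" "total w0"
    using w0 by (simp_all add: linear_order_on_def partial_order_on_def preorder_on_def)
  note w' = reflD[OF \<open>refl w0\<close>] transD[OF \<open>trans w0\<close>] antisymD[OF \<open>antisym w0\<close>]
  have tot: "(x, y) \<in> w0 \<or> (y, x) \<in> w0" for x y
    using w'(1) \<open>total w0\<close> by (cases "x = y") (auto simp: total_on_def)
  let ?C = "carrier T"
  define r where "r = (\<lambda>x y. if x \<in> ?C then y \<in> ?C \<longrightarrow> x \<sqsubseteq>\<^bsub>T\<^esub> y else y \<notin> ?C \<and> (x, y) \<in> w0)"
  have lin: "class.linorder r (\<lambda>x y. r x y \<and> \<not> r y x)"
  proof unfold_locales
    show "r x x" for x using w' by (simp add: r_def)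
    show "r x z" if "r x y" "r y z" for x y z
      using that w'(2) T.le_trans[of x y z] by (auto simp: r_def split: if_splits)
    show "x = y" if "r x y" "r y x" for x y
      using that w'(3) T.le_antisym[of x y] by (auto simp: r_def split: if_splits)
    show "r x y \<or> r y x" for x y
      using tot[of x y] T.total_order_total[of x y] by (auto simp: r_def)
  qed simp
  have car: "X \<in> carrier (Co T) \<longleftrightarrow> X \<subseteq> ?C \<and> order_convex r X" for X
  proof -
    have "z \<in> ?C" if "r z y" "y \<in> ?C" for z y using that by (auto simp: r_def split: if_splits)
    moreover have "r x z \<longleftrightarrow> x \<sqsubseteq>\<^bsub>T\<^esub> z" if "x \<in> ?C" "z \<in> ?C" for x z using that by (simp add: r_def)
    ultimately show ?thesis unfolding linorder.order_convex_iff[OF lin] Co_def partial_object.simps mem_Collect_eq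
      by (meson subsetD)
  qed
  have le: "le (Co T) = (\<subseteq>)" for T :: "'t gorder" by (simp add: Co_def)
  show ?thesis
  proof
    show "class.linorder r (\<lambda>x y. r x y \<and> \<not> r y x)" by (rule lin)
    show "order_convex r X" if "X \<in> carrier (Co T)" for X using that car by simp
    fix X Y assume XY: "X \<in> carrier (Co T)" "Y \<in> carrier (Co T)"
    have "chull r (X \<union> Y) \<subseteq> ?C" using XY unfolding car by (auto simp: chull_def r_def split: if_splits)
    then have "chull r (X \<union> Y) \<in> carrier (Co T)" unfolding car using linorder.order_convex_chull[OF lin] by blast
    moreover have "chull r (X \<union> Y) \<subseteq> Z" if "Z \<in> carrier (Co T)" "X \<subseteq> Z" "Y \<subseteq> Z" for Z
      using that linorder.chull_least[OF lin, of "X \<union> Y" Z] car by simp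
    ultimately have "X \<squnion>\<^bsub>Co T\<^esub> Y = chull r (X \<union> Y)"
      using XY linorder.subset_chull_Un[OF lin] by (intro C.join_equality) (simp_all add: le)
    moreover have "X \<inter> Y \<in> carrier (Co T)" using XY linorder.order_convex_Int[OF lin] unfolding car by blast
    then have "X \<sqinter>\<^bsub>Co T\<^esub> Y = X \<inter> Y"
      using XY by (intro C.meet_equality) (simp_all add: le)
    ultimately show "X \<squnion>\<^bsub>Co T\<^esub> Y = chull r (X \<union> Y) \<and> X \<sqinter>\<^bsub>Co T\<^esub> Y = X \<inter> Y" by simp
  qed
qed

lemma SUB_LO_coordinates:
  fixes L :: "'a gorder"
  assumes "L \<in> SUB_LO TYPE('i) TYPE('t)"
  obtains I :: "'i set" and r :: "'i \<Rightarrow> 't \<Rightarrow> 't \<Rightarrow> bool" and lt :: "'i \<Rightarrow> 't \<Rightarrow> 't \<Rightarrow> bool"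
    and \<phi> :: "'i \<Rightarrow> 'a \<Rightarrow> 't set"
  where "\<And>i. i \<in> I \<Longrightarrow> class.linorder (r i) (lt i)" "\<And>i. i \<in> I \<Longrightarrow> co_hom (r i) L (\<phi> i)"
    "\<And>s t. s \<in> carrier L \<Longrightarrow> t \<in> carrier L \<Longrightarrow> (\<And>i. i \<in> I \<Longrightarrow> \<phi> i s = \<phi> i t) \<Longrightarrow> s = t"
proof -
  obtain I :: "'i set" and T :: "'i \<Rightarrow> 't gorder" and e where
    T: "\<And>i. i \<in> I \<Longrightarrow> total_order (T i)" and
    e: "e \<in> lattice_hom L (lattice_prod I (\<lambda>i. Co (T i)))" and inj: "inj_on e (carrier L)"
    using assms unfolding SUB_LO_def by blast
  have "\<exists>r lt. class.linorder r lt \<and> (\<forall>X\<in>carrier (Co (T i)). order_convex r X \<and> (\<forall>Y\<in>carrier (Co (T i)).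
      X \<squnion>\<^bsub>Co (T i)\<^esub> Y = chull r (X \<union> Y) \<and> X \<sqinter>\<^bsub>Co (T i)\<^esub> Y = X \<inter> Y))" if "i \<in> I" for i
    using total_order_extension[OF T[OF that]] by metis
  then obtain r lt where r: "\<And>i. i \<in> I \<Longrightarrow> class.linorder (r i) (lt i)"
    "\<And>i X. i \<in> I \<Longrightarrow> X \<in> carrier (Co (T i)) \<Longrightarrow> order_convex (r i) X"
    "\<And>i X Y. i \<in> I \<Longrightarrow> X \<in> carrier (Co (T i)) \<Longrightarrow> Y \<in> carrier (Co (T i)) \<Longrightarrow>
      X \<squnion>\<^bsub>Co (T i)\<^esub> Y = chull (r i) (X \<union> Y) \<and> X \<sqinter>\<^bsub>Co (T i)\<^esub> Y = X \<inter> Y"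
    by metis
  have ec: "e s \<in> carrier (lattice_prod I (\<lambda>i. Co (T i)))" if "s \<in> carrier L" for s
    using e that by (auto simp: lattice_hom_def)
  then have ei: "e s i \<in> carrier (Co (T i))" if "s \<in> carrier L" "i \<in> I" for s i
    using that by (fastforce simp: lattice_prod_def)
  have ej: "e (s \<squnion>\<^bsub>L\<^esub> t) i = e s i \<squnion>\<^bsub>Co (T i)\<^esub> e t i" "e (s \<sqinter>\<^bsub>L\<^esub> t) i = e s i \<sqinter>\<^bsub>Co (T i)\<^esub> e t i"
    if "s \<in> carrier L" "t \<in> carrier L" "i \<in> I" for s t i
    using lattice_prod_join_meet[of I "\<lambda>i. Co (T i)", OF lattice_Co ec[OF that(1)] ec[OF that(2)] that(3)] e that
    by (simp_all add: lattice_hom_def join_pres_def meet_pres_def)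
  show ?thesis
  proof
    show "class.linorder (r i) (lt i)" if "i \<in> I" for i using r(1) that .
    show "co_hom (r i) L (\<lambda>s. e s i)" if "i \<in> I" for i
      unfolding co_hom_def using r(2,3)[OF that] ei ej that by simp
    show "s = t" if st: "s \<in> carrier L" "t \<in> carrier L" and "\<And>i. i \<in> I \<Longrightarrow> e s i = e t i" for s t
    proof -
      have "e s = e t"
        using that ec[OF st(1)] ec[OF st(2)] by (intro extensionalityI[of _ I]) (auto simp: lattice_prod_def PiE_iff)
      then show ?thesis using inj st by (simp add: inj_on_def)
    qed
  qed
qed

section \<open>From suitable terms to projectivity\<close>

primrec lat_eval :: "'a gorder \<Rightarrow> (nat \<Rightarrow> 'a) \<Rightarrow> trm \<Rightarrow> 'a" where
  "lat_eval L x (Var i) = x i"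
| "lat_eval L x (Join s t) = lat_eval L x s \<squnion>\<^bsub>L\<^esub> lat_eval L x t"
| "lat_eval L x (Meet s t) = lat_eval L x s \<sqinter>\<^bsub>L\<^esub> lat_eval L x t"

lemma lat_eval_closed:
  assumes "lattice L" "\<And>j. x j \<in> carrier L"
  shows "lat_eval L x t \<in> carrier L"
proof -
  interpret lattice L by fact
  show ?thesis by (induction t) (simp_all add: assms(2))
qed

lemma lat_eval_hom:
  assumes f: "f \<in> lattice_hom K L" and x: "\<And>j. x j \<in> carrier K"
  shows "f (lat_eval K x t) = lat_eval L (\<lambda>j. f (x j)) t"
proof -
  have K: "lattice K" using f by (simp add: lattice_hom_def join_pres_def)
  show ?thesis
    by (induction t) (use f lat_eval_closed[OF K, of x] x in \<open>auto simp: lattice_hom_def join_pres_def meet_pres_def\<close>)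
qed

lemma lat_eval_co_hom:
  assumes "lattice L" "co_hom r L \<phi>" and x: "\<And>j. x j \<in> carrier L"
  shows "\<phi> (lat_eval L x t) = co_eval r (\<lambda>j. \<phi> (x j)) t"
  by (induction t) (use assms(2) lat_eval_closed[OF assms(1) x] in \<open>auto simp: co_hom_def\<close>)

text \<open>The lift \<open>h\<close> evaluates \<open>\<tau> s\<close> at preimages of the elements
  \<open>g (a j)\<close>. The coordinates of \<open>K\<close> separate its elements, so
  \<open>h\<close> is a homomorphism if it is one in each coordinate, where \<open>hom\<close>
  applies to whatever convex sets occur. Homomorphisms commute with terms, so \<open>gen\<close>
  makes \<open>h\<close> a lift of \<open>g\<close>.\<close>

lemma projective_in_of_terms:
  fixes S :: "'s gorder" and W :: "'m gorder set"
  assumes S: "lattice S" and a: "\<And>j. a j \<in> carrier S"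
    and gen: "\<And>s. s \<in> carrier S \<Longrightarrow> lat_eval S a (\<tau> s) = s"
    and hom: "\<And>(r :: 't \<Rightarrow> 't \<Rightarrow> bool) lt x s t. class.linorder r lt \<Longrightarrow> \<forall>j. order_convex r (x j) \<Longrightarrow>
      s \<in> carrier S \<Longrightarrow> t \<in> carrier S \<Longrightarrow>
      co_eval r x (\<tau> (s \<sqinter>\<^bsub>S\<^esub> t)) = co_eval r x (\<tau> s) \<inter> co_eval r x (\<tau> t) \<and>
      co_eval r x (\<tau> (s \<squnion>\<^bsub>S\<^esub> t)) = chull r (co_eval r x (\<tau> s) \<union> co_eval r x (\<tau> t))"
  shows "projective_in (SUB_LO TYPE('i) TYPE('t) :: 'k gorder set) W S"
  unfolding projective_in_def
proof (intro ballI impI)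
  fix K :: "'k gorder" and M f g
  assume K: "K \<in> SUB_LO TYPE('i) TYPE('t)" and f: "f \<in> lattice_hom K M" and g: "g \<in> lattice_hom S M"
    and onto: "f ` carrier K = carrier M"
  have lK: "lattice K" using f by (simp add: lattice_hom_def join_pres_def)
  interpret S: lattice S by (rule S)
  interpret K: lattice K by (rule lK)
  have "\<exists>k\<in>carrier K. f k = g (a j)" for j
  proof -
    have "g (a j) \<in> f ` carrier K" using g a onto by (auto simp: lattice_hom_def)
    then show ?thesis by auto
  qed
  then obtain x where x: "\<And>j. x j \<in> carrier K" "\<And>j. f (x j) = g (a j)" by metis
  define h where "h = (\<lambda>s. lat_eval K x (\<tau> s))"
  have hc: "h s \<in> carrier K" for s unfolding h_def by (rule lat_eval_closed[OF lK x(1)])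
  obtain I :: "'i set" and r :: "'i \<Rightarrow> 't \<Rightarrow> 't \<Rightarrow> bool" and lt and \<phi> :: "'i \<Rightarrow> 'k \<Rightarrow> 't set" where
    r: "\<And>i. i \<in> I \<Longrightarrow> class.linorder (r i) (lt i)" "\<And>i. i \<in> I \<Longrightarrow> co_hom (r i) K (\<phi> i)"
    "\<And>s t. s \<in> carrier K \<Longrightarrow> t \<in> carrier K \<Longrightarrow> (\<And>i. i \<in> I \<Longrightarrow> \<phi> i s = \<phi> i t) \<Longrightarrow> s = t"
    using SUB_LO_coordinates[OF K] by blast
  have ev: "\<phi> i (h s) = co_eval (r i) (\<lambda>j. \<phi> i (x j)) (\<tau> s)" if "i \<in> I" for i s
    unfolding h_def by (rule lat_eval_co_hom[OF lK r(2)[OF that] x(1)])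
  have cv: "\<forall>j. order_convex (r i) (\<phi> i (x j))" if "i \<in> I" for i
    using r(2)[OF that] x(1) by (simp add: co_hom_def)
  have "h (s \<squnion>\<^bsub>S\<^esub> t) = h s \<squnion>\<^bsub>K\<^esub> h t \<and> h (s \<sqinter>\<^bsub>S\<^esub> t) = h s \<sqinter>\<^bsub>K\<^esub> h t"
    if st: "s \<in> carrier S" "t \<in> carrier S" for s t
  proof -
    have "\<phi> i (h (s \<squnion>\<^bsub>S\<^esub> t)) = \<phi> i (h s \<squnion>\<^bsub>K\<^esub> h t)" "\<phi> i (h (s \<sqinter>\<^bsub>S\<^esub> t)) = \<phi> i (h s \<sqinter>\<^bsub>K\<^esub> h t)"
      if i: "i \<in> I" for i
      using hom[OF r(1)[OF i] cv[OF i] st] r(2)[OF i] hc by (simp_all add: ev[OF i] co_hom_def)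
    then show ?thesis using r(3) hc by (metis K.join_closed K.meet_closed)
  qed
  then have "h \<in> lattice_hom S K"
    using hc lK S by (simp add: lattice_hom_def join_pres_def meet_pres_def)
  moreover have "f (h s) = g s" if "s \<in> carrier S" for s
    using lat_eval_hom[of f K M x "\<tau> s", OF f x(1)] lat_eval_hom[of g S M a "\<tau> s", OF g a] gen[OF that]
    by (simp add: h_def x(2))
  ultimately show "\<exists>h\<in>lattice_hom S K. \<forall>x\<in>carrier S. f (h x) = g x" by blast
qed

section \<open>Finite subdirectly irreducible lattices\<close>

lemma kernel_congruence:
  assumes "lattice L"
    and "\<And>s s' t t'. s \<in> carrier L \<Longrightarrow> s' \<in> carrier L \<Longrightarrow> t \<in> carrier L \<Longrightarrow> t' \<in> carrier L \<Longrightarrow>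
      \<kappa> s = \<kappa> s' \<Longrightarrow> \<kappa> t = \<kappa> t' \<Longrightarrow> \<kappa> (s \<squnion>\<^bsub>L\<^esub> t) = \<kappa> (s' \<squnion>\<^bsub>L\<^esub> t') \<and> \<kappa> (s \<sqinter>\<^bsub>L\<^esub> t) = \<kappa> (s' \<sqinter>\<^bsub>L\<^esub> t')"
  shows "lattice_congruence L {(s, t). s \<in> carrier L \<and> t \<in> carrier L \<and> \<kappa> s = \<kappa> t}" (is "lattice_congruence L ?\<theta>")
proof -
  interpret lattice L by fact
  have "equiv (carrier L) ?\<theta>"
    by (rule equivI) (auto simp: refl_on_def sym_def trans_def)
  then show ?thesis unfolding lattice_congruence_def using assms(2) by auto
qed

text \<open>A pair of distinct elements of the monolith has this property; it is all that is used of
  subdirect irreducibility.\<close>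

definition separating :: "'s gorder \<Rightarrow> 's \<Rightarrow> 's \<Rightarrow> bool" where
  "separating L \<alpha> \<beta> \<longleftrightarrow> \<alpha> \<in> carrier L \<and> \<beta> \<in> carrier L \<and> \<alpha> \<noteq> \<beta> \<and>
    (\<forall>\<theta>. lattice_congruence L \<theta> \<and> (\<alpha>, \<beta>) \<notin> \<theta> \<longrightarrow> \<theta> = Id_on (carrier L))"

lemma subdirectly_irreducible_separating:
  assumes "subdirectly_irreducible L"
  obtains \<alpha> \<beta> where "separating L \<alpha> \<beta>"
proof -
  obtain \<mu> where \<mu>: "lattice_congruence L \<mu>" "\<mu> \<noteq> Id_on (carrier L)"
    "\<And>\<theta>. lattice_congruence L \<theta> \<Longrightarrow> \<theta> \<noteq> Id_on (carrier L) \<Longrightarrow> \<mu> \<subseteq> \<theta>"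
    using assms unfolding subdirectly_irreducible_def by blast
  have eq: "refl_on (carrier L) \<mu>" "\<mu> \<subseteq> carrier L \<times> carrier L"
    using \<mu>(1) unfolding lattice_congruence_def equiv_def by auto
  then obtain \<alpha> \<beta> where "(\<alpha>, \<beta>) \<in> \<mu>" "\<alpha> \<noteq> \<beta>"
    using \<mu>(2) unfolding refl_on_def Id_on_def by fast
  then have "separating L \<alpha> \<beta>" unfolding separating_def using eq \<mu>(3) by blast
  then show ?thesis by (rule that)
qed

text \<open>Only the kernel of \<kappa> has to respect the operations; its values need not form a
  lattice. This suits traces on a set of points, which are compared without describing the joins of
  traces.\<close>

lemma separating_kernel:
  assumes "separating L \<alpha> \<beta>" "lattice L" "\<kappa> \<alpha> \<noteq> \<kappa> \<beta>"
    and "\<And>s s' t t'. s \<in> carrier L \<Longrightarrow> s' \<in> carrier L \<Longrightarrow> t \<in> carrier L \<Longrightarrow> t' \<in> carrier L \<Longrightarrow>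
      \<kappa> s = \<kappa> s' \<Longrightarrow> \<kappa> t = \<kappa> t' \<Longrightarrow> \<kappa> (s \<squnion>\<^bsub>L\<^esub> t) = \<kappa> (s' \<squnion>\<^bsub>L\<^esub> t') \<and> \<kappa> (s \<sqinter>\<^bsub>L\<^esub> t) = \<kappa> (s' \<sqinter>\<^bsub>L\<^esub> t')"
  shows "inj_on \<kappa> (carrier L)"
proof -
  have *: "{(s, t). s \<in> carrier L \<and> t \<in> carrier L \<and> \<kappa> s = \<kappa> t} = Id_on (carrier L)"
    using assms(1) kernel_congruence[OF assms(2,4)] assms(3) unfolding separating_def by blast
  show ?thesis
  proof (rule inj_onI)
    fix s t assume "s \<in> carrier L" "t \<in> carrier L" "\<kappa> s = \<kappa> t"
    then have "(s, t) \<in> Id_on (carrier L)" unfolding *[symmetric] by simp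
    then show "s = t" by auto
  qed
qed

text \<open>For a homomorphism \<phi> this says that \<open>\<phi> a\<close> is minimal among the
  nonempty images. It is stated through images because \<phi> is not yet known to be
  injective.\<close>

definition atom_of :: "'s gorder \<Rightarrow> ('s \<Rightarrow> 't set) \<Rightarrow> 's \<Rightarrow> bool" where
  "atom_of S \<phi> a \<longleftrightarrow> a \<in> carrier S \<and> \<phi> a \<noteq> {} \<and> (\<forall>s\<in>carrier S. \<phi> s \<inter> \<phi> a \<noteq> {} \<longrightarrow> \<phi> a \<subseteq> \<phi> s)"

text \<open>A system of representatives of the minimal nonempty images.\<close>

definition atom_points :: "'s gorder \<Rightarrow> ('s \<Rightarrow> 't set) \<Rightarrow> 't set \<Rightarrow> bool" where
  "atom_points S \<phi> T \<longleftrightarrow> finite T \<and> (\<forall>x\<in>T. \<exists>a. atom_of S \<phi> a \<and> \<phi> a \<inter> T = {x}) \<and>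
    (\<forall>s\<in>carrier S. \<phi> s \<noteq> {} \<longrightarrow> \<phi> s \<inter> T \<noteq> {})"

lemma atom_points_exist:
  assumes S: "lattice S" "finite (carrier S)" and hom: "co_hom r S \<phi>"
  obtains T where "atom_points S \<phi> T" "\<And>a. atom_of S \<phi> a \<Longrightarrow> u \<in> \<phi> a \<Longrightarrow> u \<in> T"
proof -
  interpret lattice S by (rule S)
  \<comment> \<open>The point is chosen from the image and not from the element, so atoms with the
    same image share it.\<close>
  define g where "g = (\<lambda>A. if u \<in> A then u else (SOME x. x \<in> A))"
  define T where "T = (\<lambda>a. g (\<phi> a)) ` {a. atom_of S \<phi> a}"
  have g: "g A \<in> A" if "A \<noteq> {}" for A using that by (auto simp: g_def some_in_eq)
  have same: "\<phi> a = \<phi> a'" if "atom_of S \<phi> a" "atom_of S \<phi> a'" "\<phi> a \<inter> \<phi> a' \<noteq> {}" for a a'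
    using that unfolding atom_of_def by blast
  have "{a. atom_of S \<phi> a} \<subseteq> carrier S" by (auto simp: atom_of_def)
  then have "finite T" unfolding T_def using S(2) finite_subset by blast
  moreover have "\<phi> a \<inter> T = {g (\<phi> a)}" if a: "atom_of S \<phi> a" for a
  proof -
    have "g (\<phi> a) \<in> \<phi> a" using a g by (auto simp: atom_of_def)
    moreover have "y = g (\<phi> a)" if y: "y \<in> \<phi> a" "y \<in> T" for y
    proof -
      obtain a' where a': "atom_of S \<phi> a'" "y = g (\<phi> a')" using y unfolding T_def by blast
      then have "y \<in> \<phi> a'" using g by (auto simp: atom_of_def)
      then have "\<phi> a = \<phi> a'" using y same[OF a a'(1)] by blast
      then show ?thesis using a'(2) by simp
    qed
    ultimately show ?thesis unfolding T_def using a by blast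
  qed
  moreover have "\<phi> s \<inter> T \<noteq> {}" if s: "s \<in> carrier S" "\<phi> s \<noteq> {}" for s
  proof -
    define N where "N = {A \<in> \<phi> ` carrier S. A \<noteq> {}}"
    have "finite N" "\<phi> s \<in> N" using S(2) s by (auto simp: N_def)
    then obtain A where A: "A \<in> N" "A \<subseteq> \<phi> s" "\<And>B. B \<in> N \<Longrightarrow> B \<subseteq> A \<Longrightarrow> A = B"
      using finite_has_minimal2[of N "\<phi> s"] by blast
    then obtain a where a: "a \<in> carrier S" "A = \<phi> a" "\<phi> a \<noteq> {}" by (auto simp: N_def)
    \<comment> \<open>If \<open>\<phi> s'\<close> meets the minimal image, the image of the meet is
      nonempty and contained in it, hence equal to it.\<close>
    have "\<phi> a \<subseteq> \<phi> s'" if "s' \<in> carrier S" "\<phi> s' \<inter> \<phi> a \<noteq> {}" for s'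
    proof -
      have "\<phi> (s' \<sqinter>\<^bsub>S\<^esub> a) = \<phi> s' \<inter> \<phi> a" using hom that a by (simp add: co_hom_def)
      then have "\<phi> s' \<inter> \<phi> a \<in> N" unfolding N_def using that a meet_closed by (metis (mono_tags, lifting) imageI mem_Collect_eq)
      then show ?thesis using A(3)[of "\<phi> s' \<inter> \<phi> a"] a by blast
    qed
    then have "atom_of S \<phi> a" using a by (simp add: atom_of_def)
    then have "g (\<phi> a) \<in> \<phi> a \<inter> T" using g a(3) by (auto simp: T_def)
    then show ?thesis using A(2) a(2) by blast
  qed
  ultimately have "atom_points S \<phi> T" unfolding atom_points_def T_def by blast
  moreover have "u \<in> T" if "atom_of S \<phi> a" "u \<in> \<phi> a" for a
    using that unfolding T_def g_def by (intro image_eqI[of _ _ a]) simp_all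
  ultimately show ?thesis by (rule that)
qed

context linorder
begin

text \<open>A point \<open>z\<close> outside a convex set has that whole set on one side. So if
  \<open>z\<close> lies between points of \<open>\<phi> s\<close> and \<open>\<phi> t\<close>, any
  other points of these sets serve as well, in particular those of \<open>T\<close>, which meets
  every nonempty image.\<close>

lemma mem_join_iff:
  assumes T: "atom_points S \<phi> T" and hom: "co_hom (\<le>) S \<phi>" and st: "s \<in> carrier S" "t \<in> carrier S"
  shows "z \<in> \<phi> (s \<squnion>\<^bsub>S\<^esub> t) \<longleftrightarrow> z \<in> \<phi> s \<or> z \<in> \<phi> t \<or>
    (\<exists>x\<in>\<phi> s \<inter> T. \<exists>y\<in>\<phi> t \<inter> T. x \<le> z \<and> z \<le> y \<or> y \<le> z \<and> z \<le> x)"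
proof -
  have cv: "order_convex (\<le>) (\<phi> s)" "order_convex (\<le>) (\<phi> t)" and j: "\<phi> (s \<squnion>\<^bsub>S\<^esub> t) = chull (\<le>) (\<phi> s \<union> \<phi> t)"
    using hom st by (simp_all add: co_hom_def)
  have "z \<in> \<phi> (s \<squnion>\<^bsub>S\<^esub> t)" if "z \<in> \<phi> s \<or> z \<in> \<phi> t \<or>
    (\<exists>x\<in>\<phi> s \<inter> T. \<exists>y\<in>\<phi> t \<inter> T. x \<le> z \<and> z \<le> y \<or> y \<le> z \<and> z \<le> x)"
    unfolding j chull_def using that by blast
  moreover have "\<exists>x\<in>\<phi> s \<inter> T. \<exists>y\<in>\<phi> t \<inter> T. x \<le> z \<and> z \<le> y \<or> y \<le> z \<and> z \<le> x"
    if z: "z \<in> \<phi> (s \<squnion>\<^bsub>S\<^esub> t)" "z \<notin> \<phi> s" "z \<notin> \<phi> t"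
  proof -
    have side: "x \<le> z" if "a \<in> A" "x \<in> A" "a \<le> z" "z \<notin> A" "order_convex (\<le>) A" for a x A
      using that order_convexD[of A a x z] linear by blast
    have side': "z \<le> x" if "a \<in> A" "x \<in> A" "z \<le> a" "z \<notin> A" "order_convex (\<le>) A" for a x A
      using that order_convexD[of A x a z] linear by blast
    from z(1) have "z \<in> chull (\<le>) (\<phi> s \<union> \<phi> t)" by (simp add: j)
    then obtain a b where ab: "a \<in> \<phi> s" "b \<in> \<phi> t" "a \<le> z \<and> z \<le> b \<or> b \<le> z \<and> z \<le> a"
      using cv z(2,3) mem_chull_Un_cases by metis
    then have "\<phi> s \<noteq> {}" "\<phi> t \<noteq> {}" by blast+
    then have "\<phi> s \<inter> T \<noteq> {}" "\<phi> t \<inter> T \<noteq> {}" using T st by (simp_all add: atom_points_def)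
    then obtain x y where xy: "x \<in> \<phi> s \<inter> T" "y \<in> \<phi> t \<inter> T" by blast
    have "x \<le> z \<and> z \<le> y \<or> y \<le> z \<and> z \<le> x"
      using ab(3) xy ab(1,2) z(2,3) cv side[of a "\<phi> s" x] side[of b "\<phi> t" y] side'[of a "\<phi> s" x] side'[of b "\<phi> t" y] by blast
    then show ?thesis using xy by blast
  qed
  ultimately show ?thesis by blast
qed

text \<open>If betweenness at points of \<open>Z\<close> is always witnessed inside
  \<open>Z\<close>, then the traces of \<open>s\<close> and \<open>t\<close> on \<open>Z\<close>
  determine that of their join. Meets are intersections anyway, so the kernel of the trace map is a
  congruence.\<close>

lemma separating_points:
  assumes sep: "separating S \<alpha> \<beta>" and S: "lattice S" and hom: "co_hom (\<le>) S \<phi>"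
    and Z: "\<And>s t z. s \<in> carrier S \<Longrightarrow> t \<in> carrier S \<Longrightarrow> z \<in> Z \<Longrightarrow> z \<in> \<phi> (s \<squnion>\<^bsub>S\<^esub> t) \<Longrightarrow> z \<notin> \<phi> s \<Longrightarrow> z \<notin> \<phi> t \<Longrightarrow>
      \<exists>x\<in>\<phi> s \<inter> Z. \<exists>y\<in>\<phi> t \<inter> Z. x \<le> z \<and> z \<le> y \<or> y \<le> z \<and> z \<le> x"
    and ab: "\<phi> \<alpha> \<inter> Z \<noteq> \<phi> \<beta> \<inter> Z"
  shows "inj_on (\<lambda>s. \<phi> s \<inter> Z) (carrier S)"
  using sep S ab
proof (rule separating_kernel)
  fix s s' t t'
  assume c: "s \<in> carrier S" "s' \<in> carrier S" "t \<in> carrier S" "t' \<in> carrier S"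
    and e: "\<phi> s \<inter> Z = \<phi> s' \<inter> Z" "\<phi> t \<inter> Z = \<phi> t' \<inter> Z"
  have *: "\<phi> (s \<squnion>\<^bsub>S\<^esub> t) \<inter> Z \<subseteq> \<phi> (s' \<squnion>\<^bsub>S\<^esub> t')"
    if c: "s \<in> carrier S" "s' \<in> carrier S" "t \<in> carrier S" "t' \<in> carrier S"
    and e: "\<phi> s \<inter> Z = \<phi> s' \<inter> Z" "\<phi> t \<inter> Z = \<phi> t' \<inter> Z" for s s' t t'
  proof
    fix z assume z: "z \<in> \<phi> (s \<squnion>\<^bsub>S\<^esub> t) \<inter> Z"
    have j: "\<phi> (s' \<squnion>\<^bsub>S\<^esub> t') = chull (\<le>) (\<phi> s' \<union> \<phi> t')" using hom c by (simp add: co_hom_def)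
    show "z \<in> \<phi> (s' \<squnion>\<^bsub>S\<^esub> t')"
    proof (cases "z \<in> \<phi> s \<or> z \<in> \<phi> t")
      case True
      then have "z \<in> \<phi> s' \<union> \<phi> t'" using e z by blast
      then show ?thesis unfolding j using chull_subset by blast
    next
      case False
      then obtain x y where "x \<in> \<phi> s \<inter> Z" "y \<in> \<phi> t \<inter> Z" "x \<le> z \<and> z \<le> y \<or> y \<le> z \<and> z \<le> x"
        using Z[OF c(1,3), of z] z by blast
      moreover from this have "x \<in> \<phi> s'" "y \<in> \<phi> t'" using e by blast+
      ultimately show ?thesis unfolding j chull_def by blast
    qed
  qed
  have "\<phi> (s \<sqinter>\<^bsub>S\<^esub> t) = \<phi> s \<inter> \<phi> t" "\<phi> (s' \<sqinter>\<^bsub>S\<^esub> t') = \<phi> s' \<inter> \<phi> t'" using hom c by (simp_all add: co_hom_def)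
  moreover have "\<phi> (s \<squnion>\<^bsub>S\<^esub> t) \<inter> Z = \<phi> (s' \<squnion>\<^bsub>S\<^esub> t') \<inter> Z"
    using *[OF c e] *[OF c(2,1,4,3) e[symmetric]] by blast
  ultimately show "\<phi> (s \<squnion>\<^bsub>S\<^esub> t) \<inter> Z = \<phi> (s' \<squnion>\<^bsub>S\<^esub> t') \<inter> Z \<and> \<phi> (s \<sqinter>\<^bsub>S\<^esub> t) \<inter> Z = \<phi> (s' \<sqinter>\<^bsub>S\<^esub> t') \<inter> Z"
    using e by blast
qed

text \<open>The shape of a finite subdirectly irreducible lattice with at least two atoms \<open>a 0, \<dots>, a n\<close>:
  besides them there is at most one further join-irreducible element \<open>p\<close>, which covers \<open>a (Suc c)\<close>
  and lies below the join of \<open>a c\<close> and \<open>a (Suc c)\<close>. If there is none, \<open>p = a (Suc c)\<close>.\<close>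

definition atom_chain ::
  "'s gorder \<Rightarrow> ('s \<Rightarrow> 'a set) \<Rightarrow> nat \<Rightarrow> nat \<Rightarrow> (nat \<Rightarrow> 'a) \<Rightarrow> 'a \<Rightarrow> (nat \<Rightarrow> 's) \<Rightarrow> 's \<Rightarrow> bool" where
  "atom_chain S \<phi> n c t u a p \<longleftrightarrow> c < n \<and> (\<forall>j<n. t j < t (Suc j)) \<and> t c < u \<and> u \<le> t (Suc c) \<and>
    (\<forall>j\<le>n. atom_of S \<phi> (a j) \<and> t j \<in> \<phi> (a j)) \<and>
    (\<forall>i\<le>n. \<forall>j\<le>n. i \<noteq> j \<longrightarrow> \<phi> (a i) \<inter> \<phi> (a j) = {}) \<and>
    p \<in> carrier S \<and> u \<in> \<phi> p \<and> (\<forall>s\<in>carrier S. u \<in> \<phi> s \<longrightarrow> \<phi> p \<subseteq> \<phi> s) \<and> \<phi> (a (Suc c)) \<subseteq> \<phi> p \<and>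
    (\<forall>j\<le>n. j \<noteq> Suc c \<longrightarrow> \<phi> p \<inter> \<phi> (a j) = {}) \<and>
    atom_points S \<phi> (t ` {..n}) \<and> inj_on (\<lambda>s. \<phi> s \<inter> insert u (t ` {..n})) (carrier S)"

lemma finite_set_enumeration:
  assumes "finite T" "T \<noteq> {}"
  obtains t n where "T = t ` {..n}" "\<And>i j. i < j \<Longrightarrow> j \<le> n \<Longrightarrow> t i < (t j :: 'a)" "card T = Suc (n :: nat)"
proof -
  define xs where "xs = sorted_list_of_set T"
  have xs: "set xs = T" "sorted_wrt (<) xs" "length xs = card T"
    unfolding xs_def using assms(1) by simp_all
  obtain n where n: "card T = Suc n" using assms by (metis card_eq_0_iff not0_implies_Suc)
  have "T = (\<lambda>i. xs ! i) ` {..n}" using xs n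
    by (metis atLeast0LessThan atLeast0AtMost lessThan_Suc_atMost list.set_map map_nth set_upt)
  moreover have "xs ! i < xs ! j" if "i < j" "j \<le> n" for i j
    using xs that n by (simp add: sorted_wrt_nth_less)
  ultimately show ?thesis using that n by blast
qed

end

lemma smallest_element_exists:
  assumes S: "lattice S" "finite (carrier S)" and hom: "co_hom r S \<phi>" and s: "s \<in> carrier S" "u \<in> \<phi> s"
  obtains p where "p \<in> carrier S" "u \<in> \<phi> p" "\<And>s. s \<in> carrier S \<Longrightarrow> u \<in> \<phi> s \<Longrightarrow> \<phi> p \<subseteq> \<phi> s"
proof -
  interpret lattice S by (rule S)
  define N where "N = {A \<in> \<phi> ` carrier S. u \<in> A}"
  have "finite N" "\<phi> s \<in> N" using S(2) s by (auto simp: N_def)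
  then obtain A where A: "A \<in> N" "\<And>B. B \<in> N \<Longrightarrow> B \<subseteq> A \<Longrightarrow> A = B"
    using finite_has_minimal2[of N "\<phi> s"] by blast
  then obtain p where p: "p \<in> carrier S" "A = \<phi> p" "u \<in> \<phi> p" by (auto simp: N_def)
  have "\<phi> p \<subseteq> \<phi> s'" if "s' \<in> carrier S" "u \<in> \<phi> s'" for s'
  proof -
    have "\<phi> (s' \<sqinter>\<^bsub>S\<^esub> p) = \<phi> s' \<inter> \<phi> p" using hom that p by (simp add: co_hom_def)
    then have "\<phi> s' \<inter> \<phi> p \<in> N"
      unfolding N_def using that p meet_closed by (metis (mono_tags, lifting) IntI imageI mem_Collect_eq)
    then show ?thesis using A(2)[of "\<phi> s' \<inter> \<phi> p"] p by blast
  qed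
  then show ?thesis using that p by blast
qed

context linorder
begin

lemma atom_of_disjoint_or_equal:
  "atom_of S \<phi> a \<Longrightarrow> atom_of S \<phi> a' \<Longrightarrow> \<phi> a \<inter> \<phi> a' = {} \<or> \<phi> a = \<phi> a'"
  unfolding atom_of_def by blast

lemma atom_chain_exists_atoms:
  fixes t :: "nat \<Rightarrow> 'a" and n :: nat
  assumes T: "atom_points S \<phi> T" and t: "T = t ` {..n}" "\<And>i j. i < j \<Longrightarrow> j \<le> n \<Longrightarrow> t i < t j"
  obtains a where "\<And>j. j \<le> n \<Longrightarrow> atom_of S \<phi> (a j) \<and> t j \<in> \<phi> (a j)"
    "\<And>i j. i \<le> n \<Longrightarrow> j \<le> n \<Longrightarrow> i \<noteq> j \<Longrightarrow> \<phi> (a i) \<inter> \<phi> (a j) = {}"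
    "\<And>i j. i \<le> n \<Longrightarrow> j \<le> n \<Longrightarrow> t i \<in> \<phi> (a j) \<Longrightarrow> i = j"
proof -
  have "\<exists>a. atom_of S \<phi> a \<and> \<phi> a \<inter> T = {t j}" if "j \<le> n" for j
    using T t(1) that unfolding atom_points_def by blast
  then obtain a where a: "\<And>j. j \<le> n \<Longrightarrow> atom_of S \<phi> (a j) \<and> \<phi> (a j) \<inter> T = {t j}" by metis
  have inj: "i = j" if "t i = t j" "i \<le> n" "j \<le> n" for i j
    using t(2)[of i j] t(2)[of j i] that by (cases i j rule: linorder_class.linorder_cases) auto
  have own: "i = j" if "i \<le> n" "j \<le> n" "t i \<in> \<phi> (a j)" for i j
  proof -
    have "t i \<in> T" using t(1) that(1) by blast
    then have "t i = t j" using a[OF that(2)] that(3) by blast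
    then show ?thesis using inj that by blast
  qed
  show ?thesis
  proof
    show *: "atom_of S \<phi> (a j) \<and> t j \<in> \<phi> (a j)" if "j \<le> n" for j using a[OF that] by blast
    show "\<phi> (a i) \<inter> \<phi> (a j) = {}" if "i \<le> n" "j \<le> n" "i \<noteq> j" for i j
      using atom_of_disjoint_or_equal[of S \<phi> "a i" "a j"] *[OF that(1)] *[OF that(2)] own[of i j] that by blast
    show "i = j" if "i \<le> n" "j \<le> n" "t i \<in> \<phi> (a j)" for i j using own that .
  qed
qed

text \<open>The atoms alone determine the elements, so \<open>u\<close> is chosen among their
  points: with \<open>c = 0\<close>, the element \<open>p\<close> is the atom
  \<open>a 1\<close>.\<close>

lemma atom_chain_full:
  assumes T: "atom_points S \<phi> T" and n: "1 < card T"
    and inj: "inj_on (\<lambda>s. \<phi> s \<inter> T) (carrier S)"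
  obtains n c t u a p where "atom_chain S \<phi> n c t u a p"
proof -
  have "finite T" "T \<noteq> {}" using T n by (auto simp: atom_points_def)
  then obtain t and m :: nat where t: "T = t ` {..m}" "\<And>i j. i < j \<Longrightarrow> j \<le> m \<Longrightarrow> t i < t j" "card T = Suc m"
    by (rule finite_set_enumeration) blast
  obtain a where a: "\<And>j. j \<le> m \<Longrightarrow> atom_of S \<phi> (a j) \<and> t j \<in> \<phi> (a j)"
    "\<And>i j. i \<le> m \<Longrightarrow> j \<le> m \<Longrightarrow> i \<noteq> j \<Longrightarrow> \<phi> (a i) \<inter> \<phi> (a j) = {}"
    "\<And>i j. i \<le> m \<Longrightarrow> j \<le> m \<Longrightarrow> t i \<in> \<phi> (a j) \<Longrightarrow> i = j"
    using atom_chain_exists_atoms[OF T t(1,2)] by blast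
  have m: "0 < m" using n t(3) by simp
  have "insert (t 1) T = T" using t(1) m by auto
  then have "inj_on (\<lambda>s. \<phi> s \<inter> insert (t 1) (t ` {..m})) (carrier S)" using inj t(1) by simp
  moreover have "a 1 \<in> carrier S" "\<forall>s\<in>carrier S. t 1 \<in> \<phi> s \<longrightarrow> \<phi> (a 1) \<subseteq> \<phi> s"
    using a(1)[of 1] m unfolding atom_of_def by auto
  ultimately have "atom_chain S \<phi> m 0 t (t 1) a (a 1)"
    unfolding atom_chain_def using a(1,2) t(2) m T t(1) by simp
  then show ?thesis by (rule that)
qed

lemma atom_chain_extra:
  assumes S: "lattice S" and T: "atom_points S \<phi> T" and hom: "co_hom (\<le>) S \<phi>"
    and inj: "inj_on (\<lambda>s. \<phi> s \<inter> insert u T) (carrier S)"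
    and p: "p \<in> carrier S" "u \<in> \<phi> p" "\<And>s. s \<in> carrier S \<Longrightarrow> u \<in> \<phi> s \<Longrightarrow> \<phi> p \<subseteq> \<phi> s"
    and right: "v \<in> \<phi> p \<inter> T" "\<And>x. x \<in> \<phi> p \<inter> T \<Longrightarrow> u < x" and left: "w \<in> T" "w < u"
  obtains n c t a where "atom_chain S \<phi> n c t u a p"
proof -
  have "finite T" "T \<noteq> {}" using T right by (auto simp: atom_points_def)
  then obtain t and n :: nat where t: "T = t ` {..n}" "\<And>i j. i < j \<Longrightarrow> j \<le> n \<Longrightarrow> t i < t j"
    by (rule finite_set_enumeration) blast
  obtain a where a: "\<And>j. j \<le> n \<Longrightarrow> atom_of S \<phi> (a j) \<and> t j \<in> \<phi> (a j)"
    "\<And>i j. i \<le> n \<Longrightarrow> j \<le> n \<Longrightarrow> i \<noteq> j \<Longrightarrow> \<phi> (a i) \<inter> \<phi> (a j) = {}"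
    "\<And>i j. i \<le> n \<Longrightarrow> j \<le> n \<Longrightarrow> t i \<in> \<phi> (a j) \<Longrightarrow> i = j"
    using atom_chain_exists_atoms[OF T t(1,2)] by blast
  obtain k where k: "k \<le> n" "t k \<in> \<phi> p" "u < t k" using right t(1) by auto
  have cvp: "order_convex (\<le>) (\<phi> p)" using hom p by (simp add: co_hom_def)
  \<comment> \<open>The last atom point to the left of \<open>u\<close>; it exists because of
    \<open>w\<close>.\<close>
  define c where "c = linorder_class.Max {j. j \<le> n \<and> t j < u}"
  have "{j. j \<le> n \<and> t j < u} \<noteq> {}" using left t(1) by auto
  moreover have "finite {j. j \<le> n \<and> t j < u}" by simp
  ultimately have c: "c \<le> n" "t c < u" and cmax: "\<And>j. j \<le> n \<Longrightarrow> t j < u \<Longrightarrow> j \<le> c"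
    using linorder_class.Max_in[of "{j. j \<le> n \<and> t j < u}"]
      linorder_class.Max_ge[of "{j. j \<le> n \<and> t j < u}"] unfolding c_def by blast+
  have mono: "t i \<le> t j" if "i \<le> j" "j \<le> n" for i j
    using t(2)[of i j] that by (cases "i = j") (auto intro: less_imp_le)
  have ck: "c < k"
  proof (rule ccontr)
    assume "\<not> c < k"
    then have "t k \<le> t c" using mono c by simp
    then show False using c k by simp
  qed
  then have cn: "c < n" using k by simp
  have uc: "u \<le> t (Suc c)" using cmax[of "Suc c"] cn by (meson Suc_leI Suc_n_not_le_n not_le)
  have "t (Suc c) \<le> t k" using mono ck k by simp
  then have tc: "t (Suc c) \<in> \<phi> p" using order_convexD[OF cvp p(2) k(2) uc] by simp
  have atom_le: "\<phi> (a j) \<subseteq> \<phi> p" if "j \<le> n" "\<phi> p \<inter> \<phi> (a j) \<noteq> {}" for j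
    using a(1)[OF that(1)] p(1) that(2) by (simp add: atom_of_def)
  have cvj: "order_convex (\<le>) (\<phi> (a j))" "a j \<in> carrier S" if "j \<le> n" for j
    using a(1)[OF that] hom by (simp_all add: co_hom_def atom_of_def)
  interpret lattice S by (rule S)
  have j: "\<phi> (a c \<squnion>\<^bsub>S\<^esub> a (Suc c)) = chull (\<le>) (\<phi> (a c) \<union> \<phi> (a (Suc c)))"
    using hom cvj(2)[of c] cvj(2)[of "Suc c"] cn by (simp add: co_hom_def)
  have "u \<in> chull (\<le>) (\<phi> (a c) \<union> \<phi> (a (Suc c)))"
    using a(1)[of c] a(1)[of "Suc c"] cn c(2) uc unfolding chull_def by (auto intro: less_imp_le)
  \<comment> \<open>\<open>u\<close> lies between the points of the atoms \<open>c\<close> and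
    \<open>Suc c\<close>, hence in the image of their join, and \<open>p\<close> is smallest with
    \<open>u\<close> in its image.\<close>
  then have ph: "\<phi> p \<subseteq> chull (\<le>) (\<phi> (a c) \<union> \<phi> (a (Suc c)))"
    using p(3)[of "a c \<squnion>\<^bsub>S\<^esub> a (Suc c)"] join_closed cvj(2)[of c] cvj(2)[of "Suc c"] cn j by simp
  \<comment> \<open>A further atom inside \<open>\<phi> p\<close> would have its point beyond
    \<open>t (Suc c)\<close>, yet below some point of the atom \<open>c\<close> or
    \<open>Suc c\<close>; convexity would place it into that atom.\<close>
  have pdis: "\<phi> p \<inter> \<phi> (a j) = {}" if j: "j \<le> n" "j \<noteq> Suc c" for j
  proof (rule ccontr)
    assume "\<not> ?thesis"
    then have "t j \<in> \<phi> p" using atom_le a(1) j(1) by blast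
    then have "u < t j" using right(2)[of "t j"] t(1) j(1) by blast
    have "Suc c < j"
    proof (rule ccontr)
      assume "\<not> Suc c < j"
      then have "t j \<le> t c" using mono[of j c] j c by simp
      then show False using \<open>u < t j\<close> c(2) by (meson leD less_trans)
    qed
    obtain y where "y \<in> \<phi> (a c) \<union> \<phi> (a (Suc c))" "t j \<le> y"
      using \<open>t j \<in> \<phi> p\<close> ph unfolding chull_def by blast
    then obtain i where i: "i = c \<or> i = Suc c" "y \<in> \<phi> (a i)" by blast
    then have "i \<le> n" "i < j" using cn \<open>Suc c < j\<close> by auto
    then have "t j \<in> \<phi> (a i)"
      using order_convexD[OF cvj(1), of i "t i" y "t j"] a(1)[of i] i(2) mono[of i j] j(1) \<open>t j \<le> y\<close> by simp
    then show False using a(3)[of j i] j(1) \<open>i \<le> n\<close> \<open>i < j\<close> by simp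
  qed
  have "\<phi> (a (Suc c)) \<subseteq> \<phi> p" using atom_le[of "Suc c"] tc a(1)[of "Suc c"] cn by auto
  then have "atom_chain S \<phi> n c t u a p"
    unfolding atom_chain_def using cn t(2) c(2) uc a(1,2) p pdis T inj t(1) by simp
  then show ?thesis by (rule that)
qed

end

lemma co_hom_dual: "co_hom (\<lambda>x y. r y x) = co_hom r"
  unfolding co_hom_def fun_eq_iff chull_dual[of r] order_convex_dual[of r] by simp

context linorder
begin

text \<open>A point \<open>u\<close> that distinguishes \<alpha> from \<beta> is added only if the
  atom points fail to do so. It then suffices alone unless it has atom points on both sides; in that
  case the side on which \<open>p\<close> has its atom points decides between the order and its
  dual.\<close>

lemma atom_chain_or_two_element:
  assumes sep: "separating S \<alpha> \<beta>" and S: "lattice S" "finite (carrier S)" and hom: "co_hom (\<le>) S \<phi>"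
    and ne: "\<phi> \<alpha> \<noteq> \<phi> \<beta>"
  shows "(\<exists>u. inj_on (\<lambda>s. \<phi> s \<inter> {u}) (carrier S)) \<or> (\<exists>n c t u a p. atom_chain S \<phi> n c t u a p) \<or>
    (\<exists>n c t u a p. linorder.atom_chain (\<lambda>x y. y \<le> x) (\<lambda>x y. y < x) S \<phi> n c t u a p)"
proof -
  note dual = dual_linorder
  have ab: "\<alpha> \<in> carrier S" "\<beta> \<in> carrier S" using sep by (simp_all add: separating_def)
  obtain u where u: "(u \<in> \<phi> \<alpha>) \<noteq> (u \<in> \<phi> \<beta>)" using ne by blast
  obtain T where T: "atom_points S \<phi> T" using atom_points_exist[OF S hom] by blast
  have Z: "inj_on (\<lambda>s. \<phi> s \<inter> Z) (carrier S)" if "T \<subseteq> Z" "\<phi> \<alpha> \<inter> Z \<noteq> \<phi> \<beta> \<inter> Z" for Z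
  proof (rule separating_points[OF sep S(1) hom _ that(2)])
    fix s t z assume "s \<in> carrier S" "t \<in> carrier S" "z \<in> \<phi> (s \<squnion>\<^bsub>S\<^esub> t)" "z \<notin> \<phi> s" "z \<notin> \<phi> t"
    then have "\<exists>x\<in>\<phi> s \<inter> T. \<exists>y\<in>\<phi> t \<inter> T. x \<le> z \<and> z \<le> y \<or> y \<le> z \<and> z \<le> x"
      using mem_join_iff[OF T hom, of s t z] by blast
    then show "\<exists>x\<in>\<phi> s \<inter> Z. \<exists>y\<in>\<phi> t \<inter> Z. x \<le> z \<and> z \<le> y \<or> y \<le> z \<and> z \<le> x"
      using that(1) by blast
  qed
  show ?thesis
  proof (cases "\<phi> \<alpha> \<inter> T = \<phi> \<beta> \<inter> T")
    case False
    have inj: "inj_on (\<lambda>s. \<phi> s \<inter> T) (carrier S)" using Z[of T] False by simp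
    show ?thesis
    proof (cases "1 < card T")
      case True
      show ?thesis by (rule atom_chain_full[OF T True inj]) blast
    next
      case card: False
      have "T \<noteq> {}" using False by (metis Int_empty_right)
      moreover have "finite T" using T by (simp add: atom_points_def)
      ultimately have "card T \<noteq> 0" by simp
      then have "card T = 1" using card by linarith
      then obtain v where "T = {v}" using card_1_singletonE by blast
      then show ?thesis using inj by blast
    qed
  next
    case same: True
    have uT: "u \<notin> T" using same u by blast
    have inj: "inj_on (\<lambda>s. \<phi> s \<inter> insert u T) (carrier S)" using Z[of "insert u T"] u by blast
    \<comment> \<open>Without atom points on both sides, no join can newly acquire \<open>u\<close>,
      so \<open>{u}\<close> itself satisfies the betweenness condition.\<close>
    have u1: "inj_on (\<lambda>s. \<phi> s \<inter> {u}) (carrier S)"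
      if no: "\<not> (\<exists>x\<in>T. \<exists>y\<in>T. x < u \<and> u < y)"
    proof (rule separating_points[OF sep S(1) hom])
      fix s t z assume "s \<in> carrier S" "t \<in> carrier S" "z \<in> {u}" "z \<in> \<phi> (s \<squnion>\<^bsub>S\<^esub> t)" "z \<notin> \<phi> s" "z \<notin> \<phi> t"
      then obtain x y where "x \<in> T" "y \<in> T" "x \<le> u \<and> u \<le> y \<or> y \<le> u \<and> u \<le> x"
        using mem_join_iff[OF T hom, of s t z] by blast
      then have False using no uT by (metis order.not_eq_order_implies_strict)
      then show "\<exists>x\<in>\<phi> s \<inter> {u}. \<exists>y\<in>\<phi> t \<inter> {u}. x \<le> z \<and> z \<le> y \<or> y \<le> z \<and> z \<le> x" ..
    qed (use u in blast)
    obtain \<sigma> \<rho> where \<sigma>: "\<sigma> \<in> carrier S" "u \<in> \<phi> \<sigma>" and \<rho>: "\<rho> \<in> carrier S" "u \<notin> \<phi> \<rho>" and sr: "\<phi> \<sigma> \<inter> T = \<phi> \<rho> \<inter> T"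
    proof (cases "u \<in> \<phi> \<alpha>")
      case True
      show ?thesis using that[of \<alpha> \<beta>] True u ab same by blast
    next
      case False
      show ?thesis using that[of \<beta> \<alpha>] False u ab same by blast
    qed
    obtain p where p: "p \<in> carrier S" "u \<in> \<phi> p" "\<And>s. s \<in> carrier S \<Longrightarrow> u \<in> \<phi> s \<Longrightarrow> \<phi> p \<subseteq> \<phi> s"
      using smallest_element_exists[OF S hom \<sigma>] by blast
    have "\<phi> p \<noteq> {}" using p(2) by blast
    then obtain v where v: "v \<in> \<phi> p \<inter> T" using T p(1) unfolding atom_points_def by blast
    \<comment> \<open>\<rho> has the same atom points as \<sigma>, which lies above
      \<open>p\<close>. Atom points of \<open>p\<close> on both sides of \<open>u\<close> would
      force \<open>u\<close> into the convex set \<open>\<phi> \<rho>\<close>.\<close>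
    have one_side: False if "x \<in> \<phi> p \<inter> T" "y \<in> \<phi> p \<inter> T" "x < u" "u < y" for x y
    proof -
      have "x \<in> \<phi> \<rho>" "y \<in> \<phi> \<rho>" using that p(3)[OF \<sigma>] sr by blast+
      moreover have "order_convex (\<le>) (\<phi> \<rho>)" using hom \<rho>(1) by (simp add: co_hom_def)
      ultimately show False using order_convexD[of "\<phi> \<rho>" x y u] that \<rho>(2) by (simp add: less_imp_le)
    qed
    have neu: "x < u \<or> u < x" if "x \<in> T" for x using uT that by (metis linorder_cases)
    show ?thesis
    proof (cases "\<exists>x\<in>T. \<exists>y\<in>T. x < u \<and> u < y")
      case False
      then show ?thesis using u1 by blast
    next
      case True
      then obtain w1 w2 where w: "w1 \<in> T" "w1 < u" "w2 \<in> T" "u < w2" by blast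
      show ?thesis
      proof (cases "u < v")
        case True
        then have "u < x" if "x \<in> \<phi> p \<inter> T" for x using one_side[OF that v] neu that by blast
        then show ?thesis using atom_chain_extra[OF S(1) T hom inj p v _ w(1,2)] by metis
      next
        case False
        then have "v < u" using neu v by blast
        then have "x < u" if "x \<in> \<phi> p \<inter> T" for x using one_side[OF v that] neu that by blast
        moreover have "co_hom (\<lambda>x y. y \<le> x) S \<phi>" using hom by (simp add: co_hom_dual[of "(\<le>)"])
        ultimately show ?thesis using linorder.atom_chain_extra[OF dual S(1) T _ inj p v _ w(3,4)] by metis
      qed
    qed
  qed
qed

text \<open>At the true generators nothing degenerates: \<open>t j\<close> lies between
  \<open>t 0\<close> and \<open>t (Suc j)\<close> and so survives the downward pass, and
  symmetrically the upward one. One surviving point per generator is enough, as elements are later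
  compared by traces.\<close>

lemma terms_at_points:
  fixes t :: "nat \<Rightarrow> 'a" and n c :: nat
  assumes c: "c < n" and x: "\<forall>j. order_convex (\<le>) (x j)" and sub: "x (Suc c) \<subseteq> x (Suc n)"
    and dj: "\<And>i j. i \<le> n \<Longrightarrow> j \<le> n \<Longrightarrow> i \<noteq> j \<Longrightarrow> x i \<inter> x j = {}"
    and dp: "\<And>j. j \<le> n \<Longrightarrow> j \<noteq> Suc c \<Longrightarrow> x (Suc n) \<inter> x j = {}"
    and t: "\<And>j. j \<le> n \<Longrightarrow> t j \<in> x j" "\<And>i j. i \<le> j \<Longrightarrow> j \<le> n \<Longrightarrow> t i \<le> t j"
    and u: "u \<in> x (Suc n)" "t c \<le> u" "u \<le> t (Suc c)"
  shows "co_eval (\<le>) x (bot_trm n c) = {}"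
    and "\<And>j. j \<le> n \<Longrightarrow> t j \<in> co_eval (\<le>) x (atom_trm n c j) \<and> co_eval (\<le>) x (atom_trm n c j) \<subseteq> x j"
    and "u \<in> co_eval (\<le>) x (apex_trm n c) \<and> co_eval (\<le>) x (apex_trm n c) \<subseteq> x (Suc n)"
proof -
  have h: "chull (\<le>) (x j) = x j" for j using x by (simp add: order_convex_def)
  have q: "co_eval (\<le>) x (pre_apex_trm n c) = x (Suc n)"
    using sub h by (simp add: pre_apex_trm_def Un_absorb2)
  have m: "co_eval (\<le>) x (overlap_trm n c) = {}"
    unfolding overlap_trm_empty_iff[OF x c] q using dj dp by blast
  show b: "co_eval (\<le>) x (bot_trm n c) = {}" by (rule bot_trm_empty[OF c x m])
  have L: "t j \<in> co_eval (\<le>) x (left_trm n (n - j))" if "j \<le> n" for j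
    using that
  proof (induction j rule: inc_induct)
    case base then show ?case using t(1) by simp
  next
    case (step j)
    have "n - j = Suc (n - Suc j)" using step by simp
    moreover have "t 0 \<in> x 0" "t 0 \<le> t j" "t j \<le> t (Suc j)" "t j \<in> x j" using t step by simp_all
    ultimately show ?case using step by (auto simp: chull_def)
  qed
  have R: "j \<le> n \<Longrightarrow> t j \<in> co_eval (\<le>) x (right_trm n j)" for j
  proof (induction j)
    case 0 then show ?case using t(1) by simp
  next
    case (Suc j)
    then have "t j \<le> t (Suc j)" "t (Suc j) \<le> t n" "t n \<in> x n" using t by simp_all
    then show ?case using Suc L[of "Suc j"] by (auto simp: chull_def)
  qed
  have Y: "co_eval (\<le>) x (atom_trm n c j) = co_eval (\<le>) x (right_trm n j)" for j
    using order_convex_co_eval[OF x, of "right_trm n j"] by (simp add: atom_trm_def b order_convex_def)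
  show "t j \<in> co_eval (\<le>) x (atom_trm n c j) \<and> co_eval (\<le>) x (atom_trm n c j) \<subseteq> x j" if "j \<le> n" for j
    unfolding Y using R[OF that] right_trm_subset[OF that, of x] by blast
  have "u \<in> chull (\<le>) (co_eval (\<le>) x (atom_trm n c c) \<union> co_eval (\<le>) x (atom_trm n c (Suc c)))"
    unfolding chull_def Y using R[of c] R[of "Suc c"] c u by auto
  then show "u \<in> co_eval (\<le>) x (apex_trm n c) \<and> co_eval (\<le>) x (apex_trm n c) \<subseteq> x (Suc n)"
    using u(1) by (simp add: apex_trm_def b q h)
qed

text \<open>Encodes elements as traces in the form that \<open>elem_trm_hom\<close> expects, with
  joins taking indices to their hull and adding \<open>u\<close> when both \<open>c\<close> and
  \<open>Suc c\<close> are present. The last claim shows that the terms recover the elements from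
  the generators.\<close>

lemma atom_chain_trace:
  fixes t :: "nat \<Rightarrow> 'a" and n c :: nat
  assumes ch: "atom_chain S \<phi> n c t u a p" and S: "lattice S" and hom: "co_hom (\<le>) S \<phi>"
  defines "E \<equiv> \<lambda>s. {j. j \<le> n \<and> t j \<in> \<phi> s}"
  shows "s \<in> carrier S \<Longrightarrow> trace n c (E s) (u \<in> \<phi> s)"
    and "s \<in> carrier S \<Longrightarrow> s' \<in> carrier S \<Longrightarrow> E (s \<sqinter>\<^bsub>S\<^esub> s') = E s \<inter> E s' \<and> (u \<in> \<phi> (s \<sqinter>\<^bsub>S\<^esub> s') \<longleftrightarrow> u \<in> \<phi> s \<and> u \<in> \<phi> s')"
    and "s \<in> carrier S \<Longrightarrow> s' \<in> carrier S \<Longrightarrow> E (s \<squnion>\<^bsub>S\<^esub> s') = chull (\<le>) (E s \<union> E s')"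
    and "s \<in> carrier S \<Longrightarrow> s' \<in> carrier S \<Longrightarrow> u \<in> \<phi> (s \<squnion>\<^bsub>S\<^esub> s') \<longleftrightarrow>
      u \<in> \<phi> s \<or> u \<in> \<phi> s' \<or> (c \<in> chull (\<le>) (E s \<union> E s') \<and> Suc c \<in> chull (\<le>) (E s \<union> E s'))"
    and "s \<in> carrier S \<Longrightarrow> lat_eval S (\<lambda>j. if j \<le> n then a j else p) (elem_trm n c (E s) (u \<in> \<phi> s)) = s"
proof -
  interpret lattice S by (rule S)
  have c: "c < n" "t c < u" "u \<le> t (Suc c)" and t1: "\<And>j. j < n \<Longrightarrow> t j < t (Suc j)"
    and a: "\<And>j. j \<le> n \<Longrightarrow> atom_of S \<phi> (a j)" "\<And>j. j \<le> n \<Longrightarrow> t j \<in> \<phi> (a j)"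
    and dj: "\<And>i j. i \<le> n \<Longrightarrow> j \<le> n \<Longrightarrow> i \<noteq> j \<Longrightarrow> \<phi> (a i) \<inter> \<phi> (a j) = {}"
    and p: "p \<in> carrier S" "u \<in> \<phi> p" "\<And>s. s \<in> carrier S \<Longrightarrow> u \<in> \<phi> s \<Longrightarrow> \<phi> p \<subseteq> \<phi> s" "\<phi> (a (Suc c)) \<subseteq> \<phi> p"
    and dp: "\<And>j. j \<le> n \<Longrightarrow> j \<noteq> Suc c \<Longrightarrow> \<phi> p \<inter> \<phi> (a j) = {}"
    and T: "atom_points S \<phi> (t ` {..n})" and inj: "inj_on (\<lambda>s. \<phi> s \<inter> insert u (t ` {..n})) (carrier S)"
    using ch unfolding atom_chain_def by simp_all
  have ac: "a j \<in> carrier S" "\<And>s. s \<in> carrier S \<Longrightarrow> t j \<in> \<phi> s \<Longrightarrow> \<phi> (a j) \<subseteq> \<phi> s" if "j \<le> n" for j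
    using a[OF that] unfolding atom_of_def by blast+
  have t2: "i < j \<Longrightarrow> j \<le> n \<Longrightarrow> t i < t j" for i j
  proof (induction j)
    case (Suc j)
    then show ?case using t1[of j] less_trans[of "t i" "t j" "t (Suc j)"] by (cases "i = j") auto
  qed simp
  have mono: "t i \<le> t j" if "i \<le> j" "j \<le> n" for i j
    using t2[of i j] that by (cases "i = j") (auto intro: less_imp_le)
  have mono_iff: "i \<le> j" if "t i \<le> t j" "i \<le> n" "j \<le> n" for i j
  proof (rule ccontr)
    assume "\<not> i \<le> j"
    then have "t j < t i" using t2[of j i] that by simp
    then show False using that(1) by (simp add: leD)
  qed
  have cv: "order_convex (\<le>) (\<phi> s)" if "s \<in> carrier S" for s using hom that by (simp add: co_hom_def)
  have chE: "chull (\<le>) (\<phi> s \<union> \<phi> s') = \<phi> (s \<squnion>\<^bsub>S\<^esub> s')" "\<phi> (s \<sqinter>\<^bsub>S\<^esub> s') = \<phi> s \<inter> \<phi> s'"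
    if "s \<in> carrier S" "s' \<in> carrier S" for s s'
    using hom that by (simp_all add: co_hom_def)
  have gap: "u \<in> \<phi> s" if "s \<in> carrier S" "c \<in> E s" "Suc c \<in> E s" for s
    using order_convexD[OF cv[OF that(1)], of "t c" "t (Suc c)" u] that c(2,3) by (simp add: E_def less_imp_le)
  show tr: "trace n c (E s) (u \<in> \<phi> s)" if s: "s \<in> carrier S" for s
  proof -
    have "order_convex (\<le>) (E s)"
      unfolding linorder_class.order_convex_iff
    proof (intro ballI allI impI)
      fix i j k assume "i \<in> E s" "j \<in> E s" "i \<le> k \<and> k \<le> j"
      then show "k \<in> E s" using order_convexD[OF cv[OF s], of "t i" "t j" "t k"] mono by (simp add: E_def)
    qed
    moreover have "Suc c \<in> E s" if "u \<in> \<phi> s"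
      using p(3)[OF s that] p(4) a(2)[of "Suc c"] c(1) by (auto simp: E_def)
    ultimately show ?thesis using gap[OF s] unfolding trace_def by (auto simp: E_def)
  qed
  show "E (s \<sqinter>\<^bsub>S\<^esub> s') = E s \<inter> E s' \<and> (u \<in> \<phi> (s \<sqinter>\<^bsub>S\<^esub> s') \<longleftrightarrow> u \<in> \<phi> s \<and> u \<in> \<phi> s')"
    if s: "s \<in> carrier S" "s' \<in> carrier S" for s s'
    using chE(2)[OF s] by (auto simp: E_def)
  show J: "E (s \<squnion>\<^bsub>S\<^esub> s') = chull (\<le>) (E s \<union> E s')" if s: "s \<in> carrier S" "s' \<in> carrier S" for s s'
  proof
    show "chull (\<le>) (E s \<union> E s') \<subseteq> E (s \<squnion>\<^bsub>S\<^esub> s')"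
    proof
      fix k assume "k \<in> chull (\<le>) (E s \<union> E s')"
      then obtain i j where "i \<in> E s \<union> E s'" "j \<in> E s \<union> E s'" "i \<le> k" "k \<le> j" unfolding chull_nat_iff by blast
      moreover from this have "t i \<le> t k" "t k \<le> t j" "k \<le> n" using mono by (auto simp: E_def)
      ultimately show "k \<in> E (s \<squnion>\<^bsub>S\<^esub> s')"
        unfolding E_def chE(1)[OF s, symmetric] chull_def by blast
    qed
    show "E (s \<squnion>\<^bsub>S\<^esub> s') \<subseteq> chull (\<le>) (E s \<union> E s')"
    proof
      fix k assume "k \<in> E (s \<squnion>\<^bsub>S\<^esub> s')"
      then have k: "k \<le> n" "t k \<in> \<phi> (s \<squnion>\<^bsub>S\<^esub> s')" by (auto simp: E_def)
      show "k \<in> chull (\<le>) (E s \<union> E s')"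
      proof (cases "t k \<in> \<phi> s \<or> t k \<in> \<phi> s'")
        case True
        then have "k \<in> E s \<union> E s'" using k by (auto simp: E_def)
        then show ?thesis unfolding chull_nat_iff by blast
      next
        case False
        then obtain i j where "i \<in> E s" "j \<in> E s'" "t i \<le> t k \<and> t k \<le> t j \<or> t j \<le> t k \<and> t k \<le> t i"
          using k(2) unfolding mem_join_iff[OF T hom s] E_def by blast
        then have "i \<in> E s \<union> E s'" "j \<in> E s \<union> E s'" "i \<le> k \<and> k \<le> j \<or> j \<le> k \<and> k \<le> i"
          using mono_iff k(1) by (auto simp: E_def)
        then show ?thesis unfolding chull_nat_iff by blast
      qed
    qed
  qed
  show "u \<in> \<phi> (s \<squnion>\<^bsub>S\<^esub> s') \<longleftrightarrow>
      u \<in> \<phi> s \<or> u \<in> \<phi> s' \<or> (c \<in> chull (\<le>) (E s \<union> E s') \<and> Suc c \<in> chull (\<le>) (E s \<union> E s'))"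
    if s: "s \<in> carrier S" "s' \<in> carrier S" for s s'
  proof
    assume u: "u \<in> \<phi> (s \<squnion>\<^bsub>S\<^esub> s')"
    show "u \<in> \<phi> s \<or> u \<in> \<phi> s' \<or> (c \<in> chull (\<le>) (E s \<union> E s') \<and> Suc c \<in> chull (\<le>) (E s \<union> E s'))"
    proof (cases "u \<in> \<phi> s \<or> u \<in> \<phi> s'")
      case False
      then obtain i j where ij: "i \<in> E s" "j \<in> E s'" "t i \<le> u \<and> u \<le> t j \<or> t j \<le> u \<and> u \<le> t i"
        using u unfolding mem_join_iff[OF T hom s] E_def by blast
      \<comment> \<open>\<open>u\<close> may coincide with \<open>t (Suc c)\<close>. Once this is
        excluded for the witnesses, \<open>t k \<le> u\<close> does give
        \<open>k \<le> c\<close>.\<close>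
      have ne: "t i \<noteq> u" "t j \<noteq> u" using ij False by (auto simp: E_def)
      have lo: "k \<le> c" if "t k \<le> u" "t k \<noteq> u" "k \<le> n" for k
      proof (rule ccontr)
        assume "\<not> k \<le> c"
        then have "t (Suc c) \<le> t k" using mono that by simp
        then show False using c(3) that by (meson order_antisym order_trans)
      qed
      have hi: "Suc c \<le> k" if "u \<le> t k" "k \<le> n" for k
      proof (rule ccontr)
        assume "\<not> Suc c \<le> k"
        then have "t k \<le> t c" using mono c(1) by simp
        then show False using c(2) that by (meson leD order_trans)
      qed
      have "i \<le> c \<and> Suc c \<le> j \<or> j \<le> c \<and> Suc c \<le> i" using ij ne lo hi unfolding E_def by blast
      then have "c \<in> chull (\<le>) (E s \<union> E s') \<and> Suc c \<in> chull (\<le>) (E s \<union> E s')"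
        using ij(1,2) unfolding chull_nat_iff by (meson UnI1 UnI2 Suc_leD le_SucI)
      then show ?thesis by blast
    qed blast
  next
    assume "u \<in> \<phi> s \<or> u \<in> \<phi> s' \<or> (c \<in> chull (\<le>) (E s \<union> E s') \<and> Suc c \<in> chull (\<le>) (E s \<union> E s'))"
    then show "u \<in> \<phi> (s \<squnion>\<^bsub>S\<^esub> s')"
      using gap[of "s \<squnion>\<^bsub>S\<^esub> s'"] J[OF s] s mem_join_iff[OF T hom s, of u] by auto
  qed
  show "lat_eval S (\<lambda>j. if j \<le> n then a j else p) (elem_trm n c (E s) (u \<in> \<phi> s)) = s" (is "?v = s")
    if s: "s \<in> carrier S" for s
  proof -
    define x where "x = (\<lambda>j. \<phi> (if j \<le> n then a j else p))"
    have gc: "(if j \<le> n then a j else p) \<in> carrier S" for j using ac p by simp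
    have xc: "\<forall>j. order_convex (\<le>) (x j)" unfolding x_def using cv gc by blast
    have xj: "x j = \<phi> (a j)" if "j \<le> n" for j using that by (simp add: x_def)
    have xp: "x (Suc n) = \<phi> p" by (simp add: x_def)
    define b Y YP where "b = co_eval (\<le>) x (bot_trm n c)" and "Y = (\<lambda>j. co_eval (\<le>) x (atom_trm n c j))"
      and "YP = co_eval (\<le>) x (apex_trm n c)"
    have *: "b = {}" "\<And>j. j \<le> n \<Longrightarrow> t j \<in> Y j \<and> Y j \<subseteq> x j" "u \<in> YP \<and> YP \<subseteq> x (Suc n)"
      unfolding b_def Y_def YP_def
      by (rule terms_at_points[of c n x t u]; use c p a(2) dj dp mono xc in \<open>simp add: xj xp less_imp_le\<close>)+
    have v: "?v \<in> carrier S" by (rule lat_eval_closed[OF S gc])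
    have "\<phi> ?v = co_eval (\<le>) x (elem_trm n c (E s) (u \<in> \<phi> s))"
      unfolding x_def by (rule lat_eval_co_hom[OF S hom gc])
    also have "\<dots> = realized b Y YP (E s) (u \<in> \<phi> s)"
      unfolding b_def Y_def YP_def by (rule co_eval_elem_trm[OF xc]) (auto simp: E_def)
    finally have ev: "\<phi> ?v = realized b Y YP (E s) (u \<in> \<phi> s)" .
    \<comment> \<open>The value is squeezed: it stays inside \<open>\<phi> s\<close> because each
      generator used does, and it keeps every chosen point of \<open>\<phi> s\<close>. Equal traces
      then give equal elements.\<close>
    have "\<phi> ?v \<subseteq> \<phi> s" unfolding ev realized_def
    proof (rule chull_least[OF _ cv[OF s]])
      have "Y j \<subseteq> \<phi> s" if "j \<in> E s" for j
        using *(2)[of j] ac(2)[of j s] xj[of j] s that unfolding E_def by blast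
      moreover have "YP \<subseteq> \<phi> s" if "u \<in> \<phi> s" using *(3) p(3)[OF s that] xp by blast
      ultimately show "b \<union> \<Union> (Y ` E s) \<union> (if u \<in> \<phi> s then YP else {}) \<subseteq> \<phi> s" using *(1) by auto
    qed
    moreover have "t j \<in> \<phi> ?v" if "j \<le> n" "t j \<in> \<phi> s" for j
    proof -
      have "j \<in> E s" "t j \<in> Y j" using that *(2) by (auto simp: E_def)
      then show ?thesis unfolding ev realized_def
        using chull_subset[of "b \<union> \<Union> (Y ` E s) \<union> (if u \<in> \<phi> s then YP else {})"] by blast
    qed
    moreover have "u \<in> \<phi> ?v" if "u \<in> \<phi> s"
      unfolding ev realized_def using that *(3)
        chull_subset[of "b \<union> \<Union> (Y ` E s) \<union> (if u \<in> \<phi> s then YP else {})"] by auto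
    ultimately have "\<phi> ?v \<inter> insert u (t ` {..n}) = \<phi> s \<inter> insert u (t ` {..n})" by blast
    then show ?thesis using inj v s by (simp add: inj_on_def)
  qed
qed

end

section \<open>Projectivity of the possible lattices\<close>

lemma projective_of_atom_chain:
  fixes S :: "'s gorder" and W :: "'m gorder set"
  assumes lin: "class.linorder r lt" and S: "lattice S" and hom: "co_hom r S \<phi>"
    and ch: "linorder.atom_chain r lt S \<phi> n c t u a p"
  shows "projective_in (SUB_LO TYPE('i) TYPE('t) :: 'k gorder set) W S"
proof (rule projective_in_of_terms[OF S])
  define E where "E s = {j. j \<le> n \<and> t j \<in> \<phi> s}" for s
  note tr = linorder.atom_chain_trace[OF lin ch S hom, folded E_def]
  let ?\<tau> = "\<lambda>s. elem_trm n c (E s) (u \<in> \<phi> s)"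
  have c: "c < n" using ch unfolding linorder.atom_chain_def[OF lin] by blast
  show "(if j \<le> n then a j else p) \<in> carrier S" for j
    using ch unfolding linorder.atom_chain_def[OF lin] atom_of_def by simp
  show "lat_eval S (\<lambda>j. if j \<le> n then a j else p) (?\<tau> s) = s" if "s \<in> carrier S" for s
    using tr(5)[OF that] .
  fix q :: "'t \<Rightarrow> 't \<Rightarrow> bool" and lt' and x :: "nat \<Rightarrow> 't set" and s s'
  assume q: "class.linorder q lt'" "\<forall>j. order_convex q (x j)" and s: "s \<in> carrier S" "s' \<in> carrier S"
  note H = elem_trm_hom[OF q(1) c q(2) tr(1)[OF s(1)] tr(1)[OF s(2)] tr(3)[OF s] tr(4)[OF s, folded tr(3)[OF s]]]
  show "co_eval q x (?\<tau> (s \<sqinter>\<^bsub>S\<^esub> s')) = co_eval q x (?\<tau> s) \<inter> co_eval q x (?\<tau> s') \<and>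
      co_eval q x (?\<tau> (s \<squnion>\<^bsub>S\<^esub> s')) = chull q (co_eval q x (?\<tau> s) \<union> co_eval q x (?\<tau> s'))"
    using H tr(2)[OF s] by simp
qed

lemma projective_of_two_element:
  fixes S :: "'s gorder" and W :: "'m gorder set"
  assumes S: "lattice S" and hom: "co_hom r S \<phi>" and inj: "inj_on (\<lambda>s. \<phi> s \<inter> {u}) (carrier S)"
    and ab: "\<alpha> \<in> carrier S" "\<beta> \<in> carrier S" "u \<notin> \<phi> \<alpha>" "u \<in> \<phi> \<beta>" and lin: "class.linorder r lt"
  shows "projective_in (SUB_LO TYPE('i) TYPE('t) :: 'k gorder set) W S"
proof (rule projective_in_of_terms[OF S])
  interpret lattice S by (rule S)
  define a where "a = (\<lambda>j :: nat. if j = 0 then \<alpha> else \<beta>)"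
  \<comment> \<open>Preimages of bottom and top need not be comparable; taking the meet for the
    bottom makes the two values comparable.\<close>
  define \<tau> where "\<tau> = (\<lambda>s. if u \<in> \<phi> s then Var 1 else Meet (Var 0) (Var 1))"
  show "a j \<in> carrier S" for j using ab by (simp add: a_def)
  have eqI: "s = s'" if "s \<in> carrier S" "s' \<in> carrier S" "u \<in> \<phi> s \<longleftrightarrow> u \<in> \<phi> s'" for s s'
    using inj_onD[OF inj _ that(1,2)] that(3) by blast
  have m: "\<phi> (s \<sqinter>\<^bsub>S\<^esub> s') = \<phi> s \<inter> \<phi> s'" and j: "\<phi> (s \<squnion>\<^bsub>S\<^esub> s') = chull r (\<phi> s \<union> \<phi> s')"
    if "s \<in> carrier S" "s' \<in> carrier S" for s s' using hom that by (simp_all add: co_hom_def)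
  have j': "u \<in> \<phi> (s \<squnion>\<^bsub>S\<^esub> s') \<longleftrightarrow> u \<in> \<phi> s \<or> u \<in> \<phi> s'" if s: "s \<in> carrier S" "s' \<in> carrier S" for s s'
  proof (cases "u \<in> \<phi> s \<or> u \<in> \<phi> s'")
    case True
    then show ?thesis unfolding j[OF s] using linorder.chull_subset[OF lin] by blast
  next
    case False
    then have "s = s'" using eqI s by blast
    moreover have "chull r (\<phi> s') = \<phi> s'" using hom s by (simp add: co_hom_def order_convex_def)
    ultimately show ?thesis unfolding j[OF s] by simp
  qed
  show "lat_eval S a (\<tau> s) = s" if "s \<in> carrier S" for s
    by (rule eqI) (use ab that m[OF ab(1,2)] in \<open>auto simp: \<tau>_def a_def\<close>)
  fix q :: "'t \<Rightarrow> 't \<Rightarrow> bool" and lt' and x :: "nat \<Rightarrow> 't set" and s s'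
  assume q: "class.linorder q lt'" "\<forall>j. order_convex q (x j)" and s: "s \<in> carrier S" "s' \<in> carrier S"
  have h: "chull q (x 1) = x 1" "chull q (x 0 \<inter> x 1) = x 0 \<inter> x 1"
    using q(2) linorder.order_convex_Int[OF q(1), of "x 0" "x 1"] by (simp_all add: order_convex_def)
  have i: "x (Suc 0) \<union> x 0 \<inter> x (Suc 0) = x (Suc 0)" "x 0 \<inter> x (Suc 0) \<union> x (Suc 0) = x (Suc 0)" by auto
  show "co_eval q x (\<tau> (s \<sqinter>\<^bsub>S\<^esub> s')) = co_eval q x (\<tau> s) \<inter> co_eval q x (\<tau> s') \<and>
      co_eval q x (\<tau> (s \<squnion>\<^bsub>S\<^esub> s')) = chull q (co_eval q x (\<tau> s) \<union> co_eval q x (\<tau> s'))"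
    using m[OF s] j'[OF s] h i by (auto simp: \<tau>_def)
qed

theorem theorem12p4:
  fixes S :: "'s gorder"
  assumes "S \<in> SUB_LO TYPE('i1) TYPE('t1)"
    and "finite (carrier S)"
    and "subdirectly_irreducible S"
  shows "projective_in
    (SUB_LO TYPE('i2) TYPE('t2) :: 'k gorder set)
    (SUB_LO TYPE('i3) TYPE('t3) :: 'm gorder set) S"
proof -
  have S: "lattice S" using assms(3) by (simp add: subdirectly_irreducible_def)
  obtain \<alpha> \<beta> where sep: "separating S \<alpha> \<beta>"
    using subdirectly_irreducible_separating[OF assms(3)] by blast
  then have ab: "\<alpha> \<in> carrier S" "\<beta> \<in> carrier S" "\<alpha> \<noteq> \<beta>" by (simp_all add: separating_def)
  obtain I :: "'i1 set" and r :: "'i1 \<Rightarrow> 't1 \<Rightarrow> 't1 \<Rightarrow> bool" and lt and \<phi> :: "'i1 \<Rightarrow> 's \<Rightarrow> 't1 set" where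
    r: "\<And>i. i \<in> I \<Longrightarrow> class.linorder (r i) (lt i)" "\<And>i. i \<in> I \<Longrightarrow> co_hom (r i) S (\<phi> i)"
    "\<And>s t. s \<in> carrier S \<Longrightarrow> t \<in> carrier S \<Longrightarrow> (\<And>i. i \<in> I \<Longrightarrow> \<phi> i s = \<phi> i t) \<Longrightarrow> s = t"
    using SUB_LO_coordinates[OF assms(1)] by blast
  obtain i where i: "i \<in> I" "\<phi> i \<alpha> \<noteq> \<phi> i \<beta>" using r(3)[OF ab(1,2)] ab(3) by blast
  note lin = r(1)[OF i(1)] and hom = r(2)[OF i(1)]
  have dual: "class.linorder (\<lambda>x y. r i y x) (\<lambda>x y. lt i y x)" by (rule linorder.dual_linorder[OF lin])
  have dhom: "co_hom (\<lambda>x y. r i y x) S (\<phi> i)" using hom by (simp add: co_hom_dual[of "r i"])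
  from linorder.atom_chain_or_two_element[OF lin sep S assms(2) hom i(2)]
  consider u where "inj_on (\<lambda>s. \<phi> i s \<inter> {u}) (carrier S)"
    | n c t u a p where "linorder.atom_chain (r i) (lt i) S (\<phi> i) n c t u a p"
    | n c t u a p where "linorder.atom_chain (\<lambda>x y. r i y x) (\<lambda>x y. lt i y x) S (\<phi> i) n c t u a p"
    by blast
  then show ?thesis
  proof cases
    case 1
    \<comment> \<open>Which element of the pair is the bottom is not known; \<open>u\<close> belongs
      to the image of exactly one of them, and that one is the top.\<close>
    have "u \<in> \<phi> i \<alpha> \<longleftrightarrow> u \<notin> \<phi> i \<beta>" using inj_onD[OF 1 _ ab(1,2)] ab(3) by blast
    then show ?thesis
      using projective_of_two_element[OF S hom 1 ab(1,2) _ _ lin] projective_of_two_element[OF S hom 1 ab(2,1) _ _ lin]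
      by blast
  next
    case 2
    then show ?thesis by (rule projective_of_atom_chain[OF lin S hom])
  next
    case 3
    then show ?thesis by (rule projective_of_atom_chain[OF dual S dhom])
  qed
qed

end
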